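(* Let $X \subset \mathbb{R}^2$ be bounded and let $\theta \in (0,1)$. Then $$\dim_{\mathrm{A}}^{\theta} P_V X \ \leq \ \frac{1}{2}\biggl(\frac{\overline{\dim}_{\mathrm{B}} X}{1-\theta} + \dim_{\mathrm{A}}^{\theta} X\biggr)$$ for $\gamma_{2,1}$-almost all $V \in G(2,1)$.
   Context: $G(2,1)$ is the Grassmannian of $1$-dimensional linear subspaces $V \subseteq \mathbb{R}^2$, equipped with its rotation-invariant Borel probability measure $\gamma_{2,1}$. $P_V \colon \mathbb{R}^2 \to V$ is orthogonal projection onto $V$, and $V$ is identified with $\mathbb{R}$. $B(x,R)$ is the closed ball with centre $x$ and radius $R$. $N_r(A)$ is the smallest number of closed balls of radius $r>0$ needed to cover the bounded set $A$. Assouad spectrum: for $X \subseteq \mathbb{R}^m$ and $\theta \in (0,1)$, $\dim_{\mathrm{A}}^\theta X$ is the infimum of all $\alpha \geq 0$ for which there exists a constant $C>0$ such that $N_{R^{1/\theta}}(X \cap B(x,R)) \leq C (R/R^{1/\theta})^\alpha$ for all $0<R<1$ and all $x \in X$. Upper box dimension: for bounded $X$, $\overline{\dim}_{\mathrm{B}} X = \limsup_{r \downarrow 0} \frac{\log N_r(X)}{-\log r}$ (the empty set having dimension $0$ by convention). *)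

theory Defs
  imports "HOL-Probability.Probability"
begin

section \<open>Dimensions\<close>

text \<open>Meaningful for totally bounded sets, where the number is attained. The centres are arbitrary
  points of the ambient space. For a subset of a subspace \<open>V\<close> this gives the same number as covering
  by balls of \<open>V\<close>: the orthogonal projection to \<open>V\<close> of a centre serves as well.\<close>

definition covering_number :: "real \<Rightarrow> 'a::metric_space set \<Rightarrow> nat" where
  "covering_number r A = (LEAST n. \<exists>C. finite C \<and> card C = n \<and> A \<subseteq> (\<Union>c\<in>C. cball c r))"

definition assouad_spectrum :: "real \<Rightarrow> 'a::euclidean_space set \<Rightarrow> ereal" where
  "assouad_spectrum \<theta> X =
     Inf {ereal \<alpha> | \<alpha>. 0 \<le> \<alpha> \<and>
       (\<exists>C>0. \<forall>R. 0 < R \<and> R < 1 \<longrightarrow> (\<forall>x\<in>X.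
          real (covering_number (R powr (1/\<theta>)) (X \<inter> cball x R)) \<le> C * (R / R powr (1/\<theta>)) powr \<alpha>))}"

text \<open>Intended for bounded sets.\<close>

definition upper_box_dim :: "'a::euclidean_space set \<Rightarrow> ereal" where
  "upper_box_dim X =
     (if X = {} then 0
      else Limsup (at_right 0) (\<lambda>r. ereal (ln (real (covering_number r X)) / (- ln r))))"

section \<open>The Grassmannian\<close>

definition grassmannian :: "nat \<Rightarrow> 'a::euclidean_space set set" where
  "grassmannian m = {V. subspace V \<and> dim V = m}"

definition orth_proj :: "'a::euclidean_space set \<Rightarrow> 'a \<Rightarrow> 'a" where
  "orth_proj V x = (THE y. y \<in> V \<and> x - y \<in> V\<^sup>\<bottom>)"

text \<open>The usual metric of the Grassmannian, the operator norm of \<open>P\<^sub>V - P\<^sub>W\<close>.\<close>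

definition grassmannian_dist :: "'a::euclidean_space set \<Rightarrow> 'a set \<Rightarrow> real" where
  "grassmannian_dist V W = onorm (\<lambda>x. orth_proj V x - orth_proj W x)"

definition grassmannian_open :: "nat \<Rightarrow> 'a::euclidean_space set set \<Rightarrow> bool" where
  "grassmannian_open m U \<longleftrightarrow> U \<subseteq> grassmannian m \<and>
     (\<forall>V\<in>U. \<exists>e>0. \<forall>W\<in>grassmannian m. grassmannian_dist V W < e \<longrightarrow> W \<in> U)"

definition grassmannian_borel :: "nat \<Rightarrow> 'a::euclidean_space set measure" where
  "grassmannian_borel m = sigma (grassmannian m) {U. grassmannian_open m U}"

text \<open>The Borel probability measures on the Grassmannian that are invariant under the special
  orthogonal group. For lines in the plane there is exactly one; its existence is proved below.\<close>

definition rotation_invariant_prob :: "nat \<Rightarrow> (real ^ 'n) set measure \<Rightarrow> bool" where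
  "rotation_invariant_prob m \<gamma> \<longleftrightarrow>
     prob_space \<gamma> \<and> sets \<gamma> = sets (grassmannian_borel m) \<and>
     (\<forall>Q. rotation_matrix Q \<longrightarrow>
        (\<forall>A\<in>sets \<gamma>. emeasure \<gamma> ((\<lambda>V. (*v) Q ` V) ` A) = emeasure \<gamma> A))"


section \<open>Well-posedness: projections exist, and so does the invariant measure on lines in the plane\<close>

lemma orth_proj_unique:
  assumes "subspace V" "y \<in> V" "x - y \<in> V\<^sup>\<bottom>"
  shows "orth_proj V x = y"
  unfolding orth_proj_def
proof (rule the_equality)
  fix z assume z: "z \<in> V \<and> x - z \<in> V\<^sup>\<bottom>"
  have "z - y \<in> V" using assms z by (simp add: subspace_diff)
  moreover have "(x - y) - (x - z) \<in> V\<^sup>\<bottom>"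
    using assms z subspace_diff subspace_orthogonal_comp by blast
  ultimately have "orthogonal (z - y) (z - y)" by (auto simp: orthogonal_comp_def)
  then show "z = y" by (simp add: orthogonal_self)
qed (use assms in auto)

lemma orth_proj_props:
  assumes "subspace V"
  shows "orth_proj V x \<in> V" "x - orth_proj V x \<in> V\<^sup>\<bottom>"
proof -
  obtain y z where "y \<in> V" "z \<in> V\<^sup>\<bottom>" "x = y + z"
    using subspace_sum_orthogonal_comp[OF assms] UNIV_I[of x] by (metis set_plus_elim)
  moreover from this have "orth_proj V x = y" by (intro orth_proj_unique assms) auto
  ultimately show "orth_proj V x \<in> V" "x - orth_proj V x \<in> V\<^sup>\<bottom>" by auto
qed

lemma orth_proj_span1:
  assumes "norm u = 1" shows "orth_proj (span {u}) x = (x \<bullet> u) *\<^sub>R u"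
proof (rule orth_proj_unique)
  show "x - (x \<bullet> u) *\<^sub>R u \<in> (span {u})\<^sup>\<bottom>"
    using assms by (auto simp: orthogonal_comp_def orthogonal_def span_singleton inner_diff norm_eq_1 inner_commute)
qed (auto intro: subspace_span simp: span_mul span_base)

lemma grassmannian_dist_span1:
  assumes "norm u = 1" "norm w = 1"
  shows "grassmannian_dist (span {u}) (span {w}) \<le> 2 * norm (u - w)"
  unfolding grassmannian_dist_def
proof (rule onorm_le)
  fix x
  have "(x \<bullet> u) *\<^sub>R u - (x \<bullet> w) *\<^sub>R w = (x \<bullet> u) *\<^sub>R (u - w) + (x \<bullet> (u - w)) *\<^sub>R w"
    by (simp add: algebra_simps inner_diff_right)
  also have "norm \<dots> \<le> \<bar>x \<bullet> u\<bar> * norm (u - w) + \<bar>x \<bullet> (u - w)\<bar> * norm w"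
    by (metis norm_scaleR norm_triangle_ineq)
  also have "\<dots> \<le> (norm x * 1) * norm (u - w) + (norm x * norm (u - w)) * norm w"
    using Cauchy_Schwarz_ineq2[of x u] Cauchy_Schwarz_ineq2[of x "u-w"] assms
    by (intro add_mono mult_right_mono) auto
  finally show "norm (orth_proj (span {u}) x - orth_proj (span {w}) x) \<le> 2 * norm (u - w) * norm x"
    using assms by (simp add: orth_proj_span1 mult_ac)
qed

lemma span_sgn: "x \<noteq> 0 \<Longrightarrow> span {sgn x} = span {x::'a::euclidean_space}"
  unfolding sgn_div_norm using span_image_scale[of "{x}" "\<lambda>_. 1 / norm x"]
  by (simp add: divide_inverse)

lemma span1_in_grassmannian: "x \<noteq> 0 \<Longrightarrow> span {x} \<in> grassmannian 1"
  by (simp add: grassmannian_def dim_eq_card_independent)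

lemma open_span_preimage:
  assumes U: "grassmannian_open 1 (U :: 'a::euclidean_space set set)"
  shows "open {x. x \<noteq> 0 \<and> span {x} \<in> U}"
proof -
  have "\<exists>d>0. \<forall>y. y \<noteq> 0 \<longrightarrow> dist y x < d \<longrightarrow> span {y} \<in> U" if x: "x \<noteq> 0" "span {x} \<in> U" for x :: 'a
  proof -
    obtain e where e: "e > 0" "\<And>W. W \<in> grassmannian 1 \<Longrightarrow> grassmannian_dist (span {x}) W < e \<Longrightarrow> W \<in> U"
      using U x by (auto simp: grassmannian_open_def)
    have "isCont sgn x" using x by (intro continuous_intros isCont_sgn) auto
    then obtain d where d: "d > 0" "\<And>y. dist y x < d \<Longrightarrow> dist (sgn y) (sgn x) < e/2"
      using e(1) unfolding continuous_at_eps_delta by (metis half_gt_zero)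
    show ?thesis
    proof (intro exI[of _ d] conjI allI impI d)
      fix y assume y: "y \<noteq> 0" "dist y x < d"
      have "grassmannian_dist (span {sgn x}) (span {sgn y}) < e"
        using grassmannian_dist_span1[of "sgn x" "sgn y"] d(2)[OF y(2)] x y
        by (simp add: norm_sgn dist_norm norm_minus_commute)
      then show "span {y} \<in> U" using e(2)[OF span1_in_grassmannian[OF y(1)]] x y by (simp add: span_sgn)
    qed
  qed
  then have "openin (top_of_set (- {0})) {x. x \<noteq> 0 \<and> span {x} \<in> U}"
    unfolding openin_euclidean_subtopology_iff by fastforce
  then show ?thesis by (simp add: openin_open_eq open_Compl)
qed

lemma sets_grassmannian_borel: "sets (grassmannian_borel m) = sigma_sets (grassmannian m) {U. grassmannian_open m U}"
  unfolding grassmannian_borel_def by (rule sets_measure_of) (auto simp: grassmannian_open_def)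
lemma space_grassmannian_borel: "space (grassmannian_borel m) = grassmannian m"
  unfolding grassmannian_borel_def by (rule space_measure_of) (auto simp: grassmannian_open_def)

lemma measurable_grassmannian_borelI:
  assumes "\<And>x. x \<in> space M \<Longrightarrow> f x \<in> grassmannian m"
    "\<And>U. grassmannian_open m U \<Longrightarrow> f -` U \<inter> space M \<in> sets M"
  shows "f \<in> measurable M (grassmannian_borel m)"
  unfolding grassmannian_borel_def
  using assms by (intro measurable_measure_of) (auto simp: grassmannian_open_def)

definition line_through :: "real^'n \<Rightarrow> (real^'n) set" where
  "line_through x = (if x = 0 then span {axis undefined 1} else span {x :: real^'n})"

lemma measurable_line_through: "line_through \<in> measurable borel (grassmannian_borel 1)"
proof (rule measurable_grassmannian_borelI)
  show "line_through x \<in> grassmannian 1" for x :: "real^'n" by (auto simp: line_through_def axis_eq_0_iff simp del: One_nat_def intro!: span1_in_grassmannian)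
  fix U :: "(real^'n) set set" assume U: "grassmannian_open 1 U"
  have "line_through -` U = {x. x \<noteq> 0 \<and> span {x} \<in> U} \<union> (if line_through 0 \<in> U then {0} else {})"
    by (auto simp: line_through_def split: if_splits)
  also have "\<dots> \<in> sets borel" using open_span_preimage[OF U] by auto
  finally show "line_through -` U \<inter> space borel \<in> sets borel" by simp
qed

lemma grassmannian_orthogonal_image:
  fixes g :: "'a::euclidean_space \<Rightarrow> 'a"
  assumes g: "orthogonal_transformation g"
  shows "V \<in> grassmannian m \<Longrightarrow> g ` V \<in> grassmannian m"
    "V \<in> grassmannian m \<Longrightarrow> W \<in> grassmannian m \<Longrightarrow> grassmannian_dist (g ` V) (g ` W) = grassmannian_dist V W"
proof -
  have l: "linear g" "inj g" "surj g" using g by (auto simp: orthogonal_transformation_linear orthogonal_transformation_inj orthogonal_transformation_surj)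
  show "V \<in> grassmannian m \<Longrightarrow> g ` V \<in> grassmannian m"
    using l by (auto simp: grassmannian_def linear_subspace_image dim_image_eq inj_on_subset)
  have p: "orth_proj (g ` V) (g x) = g (orth_proj V x)" if "V \<in> grassmannian m" for V x
  proof (rule orth_proj_unique)
    have s: "subspace V" using that by (simp add: grassmannian_def)
    then show "subspace (g ` V)" using l by (simp add: linear_subspace_image)
    show "g (orth_proj V x) \<in> g ` V" using orth_proj_props[OF s] by auto
    show "g x - g (orth_proj V x) \<in> (g ` V)\<^sup>\<bottom>"
      using orth_proj_props(2)[OF s, of x] g
      by (auto simp: orthogonal_comp_def orthogonal_transformation_def orthogonal_def linear_diff[symmetric])
  qed
  assume V: "V \<in> grassmannian m" and W: "W \<in> grassmannian m"
  have n: "norm (g x) = norm x" for x using g by (simp add: orthogonal_transformation)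
  have "range (\<lambda>x. norm (orth_proj (g ` V) x - orth_proj (g ` W) x) / norm x)
      = (\<lambda>x. norm (orth_proj (g ` V) x - orth_proj (g ` W) x) / norm x) ` (range g)"
    using l by simp
  also have "\<dots> = range (\<lambda>x. norm (orth_proj V x - orth_proj W x) / norm x)"
    unfolding image_image p[OF V] p[OF W] linear_diff[OF l(1), symmetric] n ..
  finally show "grassmannian_dist (g ` V) (g ` W) = grassmannian_dist V W"
    unfolding grassmannian_dist_def onorm_def by simp
qed

lemma measurable_image_orthogonal:
  fixes g :: "'a::euclidean_space \<Rightarrow> 'a"
  assumes g: "orthogonal_transformation g"
  shows "(`) g \<in> measurable (grassmannian_borel m) (grassmannian_borel m)"
proof (rule measurable_grassmannian_borelI, unfold space_grassmannian_borel)
  show "V \<in> grassmannian m \<Longrightarrow> g ` V \<in> grassmannian m" for V by (rule grassmannian_orthogonal_image[OF g])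
  fix U :: "'a set set" assume U: "grassmannian_open m U"
  have "grassmannian_open m ((`) g -` U \<inter> grassmannian m)"
    unfolding grassmannian_open_def
  proof safe
    fix V assume V: "V \<in> grassmannian m" "g ` V \<in> U"
    then obtain e where e: "e > 0" "\<And>W. W \<in> grassmannian m \<Longrightarrow> grassmannian_dist (g ` V) W < e \<Longrightarrow> W \<in> U"
      using U by (auto simp: grassmannian_open_def)
    show "\<exists>e>0. \<forall>W\<in>grassmannian m. grassmannian_dist V W < e \<longrightarrow> W \<in> (`) g -` U \<inter> grassmannian m"
      using e grassmannian_orthogonal_image[OF g] V by (intro exI[of _ e]) auto
  qed
  then show "(`) g -` U \<inter> grassmannian m \<in> sets (grassmannian_borel m)"
    unfolding sets_grassmannian_borel by auto
qed

lemma rotation_invariant_prob_exists: "\<exists>\<gamma> :: (real^2) set measure. rotation_invariant_prob 1 \<gamma>"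
proof -
  let ?B = "ball 0 1 :: (real^2) set"
  define u where "u = uniform_measure lborel ?B"
  define \<gamma> where "\<gamma> = distr u (grassmannian_borel 1) line_through"
  have B: "emeasure lborel ?B \<noteq> 0" "emeasure lborel ?B \<noteq> \<infinity>"
    using emeasure_lborel_ball_finite[of "0::real^2" 1] content_ball_pos[of 1 "0::real^2"]
    by (auto simp: measure_def)
  interpret u: prob_space u unfolding u_def using B by (intro prob_space_uniform_measure) auto
  have lm: "line_through \<in> measurable u (grassmannian_borel 1)" 
    using measurable_line_through unfolding u_def by (simp add: measurable_def)
  have "emeasure \<gamma> ((\<lambda>V. (*v) Q ` V) ` A) = emeasure \<gamma> A" if Q: "rotation_matrix Q" and A: "A \<in> sets \<gamma>" for Q A
  proof -
    define g where "g = (*v) Q"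
    have g: "orthogonal_transformation g"
      using Q unfolding g_def rotation_matrix_def orthogonal_transformation_matrix by simp
    obtain h where h: "orthogonal_transformation h" "\<And>x. h (g x) = x" "\<And>x. g (h x) = x"
      using orthogonal_transformation_inv[OF g] orthogonal_transformation_surj[OF g] orthogonal_transformation_inj[OF g]
      by (metis inv_f_f surj_f_inv_f)
    have A': "A \<in> sets (grassmannian_borel 1)" using A by (simp add: \<gamma>_def)
    then have AG: "A \<subseteq> grassmannian 1" using sets.sets_into_space space_grassmannian_borel by blast
    have hg: "h ` g ` V = V" "g ` h ` V = V" for V using h by (auto simp: image_image)
    have gA: "(`) g ` A = (`) h -` A \<inter> grassmannian 1"
    proof (intro equalityI subsetI)
      fix W assume "W \<in> (`) g ` A" then show "W \<in> (`) h -` A \<inter> grassmannian 1"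
        using hg AG grassmannian_orthogonal_image(1)[OF g, of _ 1] by auto
    next
      fix V assume "V \<in> (`) h -` A \<inter> grassmannian 1" then show "V \<in> (`) g ` A"
        using hg by (metis IntD1 imageI vimageD)
    qed
    have gAs: "(`) g ` A \<in> sets (grassmannian_borel 1)"
      using measurable_sets[OF measurable_image_orthogonal[OF h(1)] A'] unfolding gA space_grassmannian_borel .
    have *: "emeasure \<gamma> A = emeasure lborel (?B \<inter> line_through -` A - {0}) / emeasure lborel ?B" 
      and Ss: "?B \<inter> line_through -` A - {0} \<in> sets borel"
      if A': "A \<in> sets (grassmannian_borel 1)" for A
    proof -
      have s: "line_through -` A \<in> sets borel" using measurable_sets[OF measurable_line_through A'] by simp
      then show "?B \<inter> line_through -` A - {0} \<in> sets borel" by auto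
      have "emeasure \<gamma> A = emeasure u (line_through -` A)"
        unfolding \<gamma>_def by (subst emeasure_distr[OF lm A']) (simp add: u_def)
      also have "\<dots> = emeasure lborel (?B \<inter> line_through -` A) / emeasure lborel ?B"
        using s unfolding u_def by (subst emeasure_uniform_measure) auto
      also have "emeasure lborel (?B \<inter> line_through -` A) = emeasure lborel (?B \<inter> line_through -` A - {0})"
        using s by (intro emeasure_Diff_null_set[symmetric]) (auto simp: null_sets_def)
      finally show "emeasure \<gamma> A = emeasure lborel (?B \<inter> line_through -` A - {0}) / emeasure lborel ?B" .
    qed
    have lg: "linear g" using g by (simp add: orthogonal_transformation_linear)
    have n: "norm (g x) = norm x" for x using g by (simp add: orthogonal_transformation)
    have z: "g x = 0 \<longleftrightarrow> x = 0" for x using n[of x] by (metis norm_eq_zero)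
    have li: "line_through (g x) = g ` line_through x" if "x \<noteq> 0" for x
      using that z by (simp add: line_through_def linear_span_image[OF lg, of "{x}", simplified])
    have li2: "line_through (g x) \<in> (`) g ` A \<longleftrightarrow> line_through x \<in> A" if x0: "x \<noteq> 0" for x
    proof -
      have "inj ((`) g)" by (rule injI) (metis hg(1))
      from inj_image_mem_iff[OF this] show ?thesis unfolding li[OF x0] .
    qed
    have "?B \<inter> line_through -` ((`) g ` A) - {0} = g ` (?B \<inter> line_through -` A - {0})"
    proof (intro equalityI subsetI)
      fix y assume y: "y \<in> ?B \<inter> line_through -` ((`) g ` A) - {0}"
      have e: "y = g (h y)" using h by simp
      have y0: "h y \<noteq> 0" using y z[of "h y"] h(3) by auto
      have "h y \<in> ?B" using y n[of "h y"] h by simp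
      moreover have "line_through (h y) \<in> A" using li2[OF y0] y e by simp
      ultimately show "y \<in> g ` (?B \<inter> line_through -` A - {0})" using y0 e by blast
    next
      fix y assume "y \<in> g ` (?B \<inter> line_through -` A - {0})"
      then obtain x where "x \<in> ?B" "line_through x \<in> A" "x \<noteq> 0" "y = g x" by (elim imageE) (simp, blast)
      then show "y \<in> ?B \<inter> line_through -` ((`) g ` A) - {0}" using li2[of x] n[of x] z[of x] by simp
    qed
    note eqS = this
    have "emeasure lborel (g ` (?B \<inter> line_through -` A - {0})) = emeasure lborel (?B \<inter> line_through -` A - {0})"
    proof -
      let ?S = "?B \<inter> line_through -` A - {0}"
      have S: "?S \<in> lmeasurable" using Ss[OF A'] by (intro bounded_set_imp_lmeasurable bounded_subset[OF bounded_ball]) auto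
      have b: "g ` ?S \<in> sets borel" using Ss[OF gAs] eqS by simp
      have "emeasure lebesgue (g ` ?S) = emeasure lebesgue ?S"
        using measure_orthogonal_image[OF g S] Change_Of_Vars.measurable_orthogonal_image[OF g S] S
        by (simp add: emeasure_eq_measure2 fmeasurableD2)
      then show ?thesis using b Ss[OF A'] by simp
    qed
    then show ?thesis using *[OF A'] *[OF gAs] eqS by (simp add: g_def)
  qed
  moreover have "prob_space \<gamma>" unfolding \<gamma>_def by (rule u.prob_space_distr[OF lm])
  ultimately show ?thesis unfolding rotation_invariant_prob_def by (intro exI[of _ \<gamma>]) (auto simp: \<gamma>_def)
qed

end

theory Submission
  imports Defs
begin

text \<open>
  Write \<open>r = R\<^sup>1\<^sup>/\<^sup>\<theta>\<close> and let \<open>E\<close> be the set of centres of a minimal cover of \<open>X\<close> by \<open>r\<close>-balls. The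
  number of \<open>r\<close>-balls needed for \<open>P\<^sub>V X \<inter> B(y,R)\<close> is at most the number of points of \<open>E\<close> in a strip
  of width comparable to \<open>R\<close>. Choose a strip \<open>S\<^sub>j\<close> for each of about \<open>1/R\<close> equally spaced directions.
  Two strips at angle \<open>s\<close> meet in a parallelogram covered by about \<open>1/s\<close> balls of radius \<open>R\<close>, each
  containing at most about \<open>n = (R/r)\<^sup>\<alpha>\<close> points of \<open>E\<close>, so Cauchy-Schwarz bounds the mean of
  \<open>|E \<inter> S\<^sub>j|\<close> over \<open>j\<close> by the square root of \<open>|E| n log(1/R)\<close>, up to a constant. Hence the directions having a
  strip with \<open>|E \<inter> S|\<^sup>2 > |E| n R\<^sup>-\<^sup>2\<^sup>\<epsilon>\<close> are contained in arcs of total measure at most about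
  \<open>R\<^sup>\<epsilon>\<close> up to logarithms, and Borel-Cantelli over dyadic \<open>R\<close> discards them. Since \<open>|E| \<le> r\<^sup>-\<^sup>d\<close>, the
  remaining directions satisfy the claim.
\<close>

section \<open>Covering numbers\<close>

lemma covering_number_le:
  assumes "finite C" "A \<subseteq> (\<Union>c\<in>C. cball c r)"
  shows "covering_number r A \<le> card C"
  unfolding covering_number_def by (intro Least_le exI[of _ C]) (use assms in simp)

text \<open>The \<open>LEAST\<close> in \<open>covering_number\<close> is attained only if some
  finite cover exists; total boundedness of the compact closure supplies one.\<close>

lemma bounded_obtain_cover:
  fixes A :: "'a::euclidean_space set"
  assumes "bounded A" "0 < r"
  obtains C where "finite C" "card C = covering_number r A" "A \<subseteq> (\<Union>c\<in>C. cball c r)"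
proof -
  have "compact (closure A)"
    using assms(1) by simp
  then obtain C where "finite C" "closure A \<subseteq> (\<Union>c\<in>C. ball c r)"
    using assms(2) unfolding compact_eq_totally_bounded by blast
  have "A \<subseteq> (\<Union>c\<in>C. cball c r)"
  proof
    fix x assume "x \<in> A"
    then obtain c where "c \<in> C" "dist c x < r"
      using closure_subset[of A] \<open>closure A \<subseteq> _\<close> by auto
    then show "x \<in> (\<Union>c\<in>C. cball c r)" by force
  qed
  then have "\<exists>n C. finite C \<and> card C = n \<and> A \<subseteq> (\<Union>c\<in>C. cball c r)"
    using \<open>finite C\<close> by blast
  then show thesis
    using that LeastI_ex[of "\<lambda>n. \<exists>C. finite C \<and> card C = n \<and> A \<subseteq> (\<Union>c\<in>C. cball c r)"]
    unfolding covering_number_def by blast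
qed

lemma covering_number_mono:
  fixes A B :: "'a::euclidean_space set"
  assumes "A \<subseteq> B" "bounded B" "0 < r" "r \<le> s"
  shows "covering_number s A \<le> covering_number r B"
proof -
  obtain C where C: "finite C" "card C = covering_number r B" "B \<subseteq> (\<Union>c\<in>C. cball c r)"
    by (rule bounded_obtain_cover[OF assms(2,3)])
  have "A \<subseteq> (\<Union>c\<in>C. cball c s)"
  proof
    fix x assume "x \<in> A"
    then obtain c where "c \<in> C" "dist c x \<le> r" using C(3) assms(1) by auto
    then show "x \<in> (\<Union>c\<in>C. cball c s)" using assms(4) by force
  qed
  then show ?thesis
    using covering_number_le[OF C(1)] C(2) by metis
qed

lemma covering_number_pos:
  fixes A :: "'a::euclidean_space set"
  assumes "bounded A" "0 < r" "A \<noteq> {}"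
  shows "0 < covering_number r A"
proof -
  obtain C where C: "finite C" "card C = covering_number r A" "A \<subseteq> (\<Union>c\<in>C. cball c r)"
    by (rule bounded_obtain_cover[OF assms(1,2)])
  then have "C \<noteq> {}"
    using assms(3) by auto
  then show ?thesis
    using C(1) unfolding C(2)[symmetric] by (simp add: card_gt_0_iff)
qed

text \<open>The hypothesis concerns balls of radius \<open>R\<close> centred in \<open>X\<close>,
  the conclusion larger balls with any centre. Cover \<open>cball 0 c\<close> by balls of radius 1/2
  and transport them by scaling with \<open>R\<close> and translating to \<open>z\<close>: each copy
  misses \<open>X\<close> or lies in a ball of radius \<open>R\<close> about one of its points of
  \<open>X\<close>. Only \<open>c\<close> and the dimension enter \<open>K\<close>, so it is chosen
  before \<open>X\<close> and the scales.\<close>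

lemma covering_number_cball_scale:
  assumes "0 \<le> (c::real)"
  obtains K :: nat where
    "\<And>(X :: 'a::euclidean_space set) z R r n. bounded X \<Longrightarrow> 0 < R \<Longrightarrow> 0 < r \<Longrightarrow>
      (\<And>x. x \<in> X \<Longrightarrow> real (covering_number r (X \<inter> cball x R)) \<le> n) \<Longrightarrow> 0 \<le> n \<Longrightarrow>
      real (covering_number r (X \<inter> cball z (c * R))) \<le> real K * n"
proof -
  have "0 < (1/2::real)" by simp
  obtain D where D: "finite D" "card D = covering_number (1/2) (cball (0::'a) c)"
      "cball (0::'a) c \<subseteq> (\<Union>d\<in>D. cball d (1/2))"
    by (rule bounded_obtain_cover[OF bounded_cball \<open>0 < 1/2\<close>])
  have *: "real (covering_number r (X \<inter> cball z (c * R))) \<le> real (card D) * n"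
    if X: "bounded X" "0 < R" "0 < r" and n: "0 \<le> n"
      and le: "\<And>x. x \<in> X \<Longrightarrow> real (covering_number r (X \<inter> cball x R)) \<le> n"
    for X :: "'a set" and z R r n
  proof -
    have "\<exists>C. finite C \<and> real (card C) \<le> n \<and> X \<inter> cball (z + R *\<^sub>R d) (R / 2) \<subseteq> (\<Union>c\<in>C. cball c r)"
      for d
    proof (cases "X \<inter> cball (z + R *\<^sub>R d) (R / 2) = {}")
      case True
      then show ?thesis using n by (intro exI[of _ "{}"]) auto
    next
      case False
      then obtain x where x: "x \<in> X" "dist (z + R *\<^sub>R d) x \<le> R / 2" by auto
      obtain C where C: "finite C" "card C = covering_number r (X \<inter> cball x R)"
          "X \<inter> cball x R \<subseteq> (\<Union>c\<in>C. cball c r)"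
        by (rule bounded_obtain_cover[of "X \<inter> cball x R" r]) (use X in auto)
      have "cball (z + R *\<^sub>R d) (R / 2) \<subseteq> cball x R"
      proof
        fix y assume "y \<in> cball (z + R *\<^sub>R d) (R / 2)"
        then show "y \<in> cball x R"
          using dist_triangle2[of x y "z + R *\<^sub>R d"] x(2) by (simp add: dist_commute)
      qed
      then show ?thesis
        using C le[OF x(1)] by (intro exI[of _ C]) auto
    qed
    then obtain F where F: "\<And>d. finite (F d)" "\<And>d. real (card (F d)) \<le> n"
        "\<And>d. X \<inter> cball (z + R *\<^sub>R d) (R / 2) \<subseteq> (\<Union>c\<in>F d. cball c r)"
      by metis
    have "X \<inter> cball z (c * R) \<subseteq> (\<Union>e\<in>(\<Union>d\<in>D. F d). cball e r)"
    proof
      fix y assume y: "y \<in> X \<inter> cball z (c * R)"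
      define w where "w = (1 / R) *\<^sub>R (y - z)"
      have yw: "y = z + R *\<^sub>R w"
        using X(2) by (simp add: w_def)
      have "norm (R *\<^sub>R w) \<le> c * R"
        using y by (simp add: yw dist_norm)
      then have "w \<in> cball 0 c"
        using X(2) by simp
      then obtain d where d: "d \<in> D" "norm (d - w) \<le> 1 / 2"
        using D(3) by (auto simp: dist_norm)
      have "dist (z + R *\<^sub>R d) y = R * norm (d - w)"
        using X(2) by (simp add: yw dist_norm flip: scaleR_diff_right)
      also have "\<dots> \<le> R * (1 / 2)"
        using X(2) d(2) by (intro mult_left_mono) auto
      finally have "y \<in> cball (z + R *\<^sub>R d) (R / 2)"
        by simp
      then show "y \<in> (\<Union>e\<in>(\<Union>d\<in>D. F d). cball e r)"
        using F(3)[of d] d(1) y by blast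
    qed
    then have "covering_number r (X \<inter> cball z (c * R)) \<le> card (\<Union>d\<in>D. F d)"
      using D F by (intro covering_number_le) auto
    also have "\<dots> \<le> (\<Sum>d\<in>D. card (F d))"
      by (rule card_UN_le[OF D(1)])
    finally have "real (covering_number r (X \<inter> cball z (c * R))) \<le> (\<Sum>d\<in>D. real (card (F d)))"
      by (simp flip: of_nat_sum)
    also have "\<dots> \<le> (\<Sum>d\<in>D. n)"
      by (intro sum_mono F)
    finally show ?thesis by simp
  qed
  show thesis
    by (rule that[of "card D"]) (rule *)
qed

text \<open>Minimality gives both extra properties by exchange. A ball missing \<open>X\<close>
  could be dropped. The centres in \<open>cball z \<rho>\<close> serve only points of
  \<open>cball z (\<rho> + r)\<close>, so they could be replaced by an optimal cover of that part of
  \<open>X\<close> and hence are no more numerous. Local covering bounds thus become counting bounds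
  for \<open>E\<close>.\<close>

lemma minimal_cover:
  fixes X :: "'a::euclidean_space set"
  assumes "bounded X" "0 < r"
  obtains E where "finite E" "card E = covering_number r X" "X \<subseteq> (\<Union>c\<in>E. cball c r)"
    "\<forall>c\<in>E. \<exists>x\<in>X. dist c x \<le> r"
    "\<forall>z \<rho>. card (E \<inter> cball z \<rho>) \<le> covering_number r (X \<inter> cball z (\<rho> + r))"
proof -
  obtain E where E: "finite E" "card E = covering_number r X" "X \<subseteq> (\<Union>c\<in>E. cball c r)"
    by (rule bounded_obtain_cover[OF assms(1,2)])
  have near: "\<exists>x\<in>X. dist c x \<le> r" if c: "c \<in> E" for c
  proof (rule ccontr)
    assume "\<not> (\<exists>x\<in>X. dist c x \<le> r)"
    then have "X \<subseteq> (\<Union>e\<in>E - {c}. cball e r)"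
      using E(3) by fastforce
    then have "covering_number r X \<le> card (E - {c})"
      using E(1) by (intro covering_number_le) auto
    then show False
      using E(1,2) c by (metis card_Diff1_less not_le)
  qed
  have loc: "card (E \<inter> cball z \<rho>) \<le> covering_number r (X \<inter> cball z (\<rho> + r))" for z \<rho>
  proof -
    obtain D where D: "finite D" "card D = covering_number r (X \<inter> cball z (\<rho> + r))"
        "X \<inter> cball z (\<rho> + r) \<subseteq> (\<Union>c\<in>D. cball c r)"
      by (rule bounded_obtain_cover[of "X \<inter> cball z (\<rho> + r)" r]) (use assms in auto)
    have "X \<subseteq> (\<Union>c\<in>(E - cball z \<rho>) \<union> D. cball c r)"
    proof
      fix x assume x: "x \<in> X"
      then obtain c where c: "c \<in> E" "dist c x \<le> r" using E(3) by auto
      show "x \<in> (\<Union>c\<in>(E - cball z \<rho>) \<union> D. cball c r)"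
      proof (cases "c \<in> cball z \<rho>")
        case True
        then have "x \<in> X \<inter> cball z (\<rho> + r)"
          using c x dist_triangle[of z x c] by auto
        then show ?thesis using D(3) by blast
      qed (use c in auto)
    qed
    then have "covering_number r X \<le> card ((E - cball z \<rho>) \<union> D)"
      using E D by (intro covering_number_le) auto
    also have "\<dots> \<le> card (E - cball z \<rho>) + card D"
      by (rule card_Un_le)
    finally have "card E \<le> card (E - cball z \<rho>) + card D"
      using E(2) by simp
    moreover have "card E = card (E \<inter> cball z \<rho>) + card (E - cball z \<rho>)"
      using E(1) by (metis card_Int_Diff)
    ultimately show ?thesis using D(2) by simp
  qed
  show thesis using that E near loc by blast
qed

section \<open>Strips in the plane\<close>

definition dir :: "real \<Rightarrow> real ^ 2" where
  "dir \<phi> = vector [cos \<phi>, sin \<phi>]"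

lemma inner_dir: "z \<bullet> dir \<phi> = z $ 1 * cos \<phi> + z $ 2 * sin \<phi>"
  by (simp add: dir_def inner_vec_def sum_2)

lemma inner_dir_dir: "dir \<phi> \<bullet> dir \<psi> = cos (\<phi> - \<psi>)"
  by (simp add: inner_dir cos_diff) (simp add: dir_def)

lemma norm_dir [simp]: "norm (dir \<phi>) = 1"
  by (simp add: norm_eq_sqrt_inner inner_dir_dir)

lemma norm_le_dir: "norm z \<le> \<bar>z \<bullet> dir \<phi>\<bar> + \<bar>z \<bullet> dir (\<phi> + pi / 2)\<bar>"
proof -
  have "(norm z)\<^sup>2 = (z \<bullet> dir \<phi>)\<^sup>2 + (z \<bullet> dir (\<phi> + pi / 2))\<^sup>2"
  proof -
    have "(norm z)\<^sup>2 = (z $ 1)\<^sup>2 + (z $ 2)\<^sup>2"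
      by (simp add: norm_vec_def L2_set_def sum_2)
    also have "\<dots> = (z \<bullet> dir \<phi>)\<^sup>2 + (z \<bullet> dir (\<phi> + pi / 2))\<^sup>2"
    proof -
      have "cos (\<phi> + pi / 2) = - sin \<phi>" "sin (\<phi> + pi / 2) = cos \<phi>"
        by (simp_all add: cos_add sin_add)
      then show ?thesis
        using sin_cos_squared_add[of \<phi>] unfolding inner_dir by algebra
    qed
    finally show ?thesis .
  qed
  also have "\<dots> \<le> (\<bar>z \<bullet> dir \<phi>\<bar> + \<bar>z \<bullet> dir (\<phi> + pi / 2)\<bar>)\<^sup>2"
    by (simp add: power2_sum)
  finally show ?thesis
    by (rule power2_le_imp_le) simp
qed

text \<open>Bounds on the coordinates across two strips control the coordinate along the first one,
  at the cost of dividing by the sine of their angle.\<close>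

lemma inner_dir_rotate:
  "sin (\<psi> - \<phi>) * (z \<bullet> dir (\<phi> + pi / 2)) = z \<bullet> dir \<psi> - cos (\<psi> - \<phi>) * (z \<bullet> dir \<phi>)"
proof -
  have "z \<bullet> dir \<psi> = z \<bullet> dir (\<phi> + (\<psi> - \<phi>))" by simp
  also have "\<dots> = cos (\<psi> - \<phi>) * (z \<bullet> dir \<phi>) + sin (\<psi> - \<phi>) * (z \<bullet> dir (\<phi> + pi / 2))"
    unfolding inner_dir cos_add[of \<phi>] sin_add[of \<phi>] by (simp add: algebra_simps)
  finally show ?thesis by simp
qed

text \<open>Cut \<open>F\<close> into bins of length \<open>\<rho>\<close> in the direction
  orthogonal to \<open>dir \<phi>\<close>. Two points of one bin differ by at most
  \<open>2 * c * \<rho>\<close> across and \<open>\<rho>\<close> along, so a bin lies in one of the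
  balls controlled by \<open>loc\<close>, and at most \<open>L / \<rho> + 2\<close> bins are
  occupied.\<close>

lemma card_le_bins:
  fixes F :: "(real ^ 2) set"
  assumes "finite F" "0 < \<rho>" "0 \<le> c" "0 \<le> L"
    and wide: "\<And>z w. z \<in> F \<Longrightarrow> w \<in> F \<Longrightarrow> \<bar>(z - w) \<bullet> dir \<phi>\<bar> \<le> 2 * c * \<rho>"
    and long: "\<And>z w. z \<in> F \<Longrightarrow> w \<in> F \<Longrightarrow> \<bar>(z - w) \<bullet> dir (\<phi> + pi / 2)\<bar> \<le> L"
    and loc: "\<And>z. real (card (F \<inter> cball z ((2 * c + 1) * \<rho>))) \<le> n"
  shows "real (card F) \<le> n * (L / \<rho> + 2)"
proof (cases "F = {}")
  case True
  have "0 \<le> n" using loc[of 0] by simp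
  then show ?thesis using True assms by simp
next
  case False
  then obtain z0 where z0: "z0 \<in> F" by auto
  have "0 \<le> n" using loc[of 0] by (rule order_trans[rotated]) simp
  define h where "h z = z \<bullet> dir (\<phi> + pi / 2)" for z
  define b where "b z = \<lfloor>h z / \<rho>\<rfloor>" for z
  have hd: "\<bar>h z - h w\<bar> \<le> L" if "z \<in> F" "w \<in> F" for z w
    using long[OF that] by (simp add: h_def inner_diff_left)
  define m where "m = Min (h ` F)"
  have m: "m \<in> h ` F" "\<And>z. z \<in> F \<Longrightarrow> m \<le> h z"
    using assms(1) False by (simp_all add: m_def)
  have "b ` F \<subseteq> {\<lfloor>m / \<rho>\<rfloor>..\<lfloor>(m + L) / \<rho>\<rfloor>}"
  proof clarify
    fix z assume z: "z \<in> F"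
    have "m \<le> h z" "h z \<le> m + L"
      using m z hd by fastforce+
    then show "b z \<in> {\<lfloor>m / \<rho>\<rfloor>..\<lfloor>(m + L) / \<rho>\<rfloor>}"
      using assms(2) by (auto simp: b_def intro!: floor_mono divide_right_mono)
  qed
  then have "card (b ` F) \<le> card {\<lfloor>m / \<rho>\<rfloor>..\<lfloor>(m + L) / \<rho>\<rfloor>}"
    by (intro card_mono) auto
  then have "real (card (b ` F)) \<le> real (nat (\<lfloor>(m + L) / \<rho>\<rfloor> - \<lfloor>m / \<rho>\<rfloor> + 1))"
    by (simp add: algebra_simps)
  also have "\<dots> \<le> L / \<rho> + 2"
  proof -
    \<comment> \<open>This order lets \<open>nat\<close> be removed; the 2 is one for counting both
      end bins and one for rounding.\<close>
    have "\<lfloor>m / \<rho>\<rfloor> \<le> \<lfloor>(m + L) / \<rho>\<rfloor>"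
      using assms by (intro floor_mono divide_right_mono) auto
    moreover have "(m + L) / \<rho> = m / \<rho> + L / \<rho>"
      by (simp add: add_divide_distrib)
    ultimately show ?thesis by linarith
  qed
  finally have bins: "real (card (b ` F)) \<le> L / \<rho> + 2" .
  have "real (card F) = (\<Sum>z\<in>F. 1)" by simp
  also have "\<dots> = (\<Sum>k\<in>b ` F. \<Sum>z\<in>{z \<in> F. b z = k}. 1)"
    by (rule sum.image_gen[OF assms(1)])
  also have "\<dots> \<le> (\<Sum>k\<in>b ` F. n)"
  proof (rule sum_mono)
    fix k assume "k \<in> b ` F"
    then obtain w where w: "w \<in> F" "k = b w" by auto
    have "{z \<in> F. b z = k} \<subseteq> F \<inter> cball w ((2 * c + 1) * \<rho>)"
    proof
      fix z assume "z \<in> {z \<in> F. b z = k}"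
      then have z: "z \<in> F" "b z = k" by auto
      have "\<bar>h z / \<rho> - h w / \<rho>\<bar> \<le> 1"
        using z w unfolding b_def by linarith
      then have "\<bar>h z - h w\<bar> \<le> \<rho>"
        using assms(2) by (simp add: divide_simps flip: diff_divide_distrib)
      then have "norm (z - w) \<le> 2 * c * \<rho> + \<rho>"
        using wide[OF z(1) w(1)] norm_le_dir[of "z - w" \<phi>] by (simp add: h_def inner_diff_left)
      then show "z \<in> F \<inter> cball w ((2 * c + 1) * \<rho>)"
        using z by (simp add: dist_norm norm_minus_commute algebra_simps)
    qed
    then have "card {z \<in> F. b z = k} \<le> card (F \<inter> cball w ((2 * c + 1) * \<rho>))"
      using assms(1) by (intro card_mono) auto
    then show "(\<Sum>z\<in>{z \<in> F. b z = k}. 1) \<le> n"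
      using loc[of w] by simp
  qed
  also have "\<dots> = n * real (card (b ` F))" by simp
  also have "\<dots> \<le> n * (L / \<rho> + 2)"
    using bins \<open>0 \<le> n\<close> by (intro mult_left_mono)
  finally show ?thesis .
qed

definition strip :: "real \<Rightarrow> real \<Rightarrow> real \<Rightarrow> (real ^ 2) set" where
  "strip \<phi> t w = {z. \<bar>z \<bullet> dir \<phi> - t\<bar> \<le> w}"

lemma strip_diff:
  assumes "z \<in> strip \<phi> t w" "z' \<in> strip \<phi> t w"
  shows "\<bar>(z - z') \<bullet> dir \<phi>\<bar> \<le> 2 * w"
  using assms unfolding strip_def by (simp add: inner_diff_left)

text \<open>Two transverse strips meet in a parallelogram. Both transversal coordinates vary by at
  most \<open>2 * c * \<rho>\<close>, so by \<open>inner_dir_rotate\<close> its extent along the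
  first strip is at most \<open>4 * c * \<rho>\<close> over the sine, and this extent is cut into
  bins.\<close>

lemma card_strip_Int_le:
  fixes E :: "(real ^ 2) set"
  assumes "finite E" "0 < \<rho>" "0 \<le> c" "sin (\<psi> - \<phi>) \<noteq> 0"
    and loc: "\<And>z. real (card (E \<inter> cball z ((2 * c + 1) * \<rho>))) \<le> n"
  shows "real (card (E \<inter> strip \<phi> t (c * \<rho>) \<inter> strip \<psi> t' (c * \<rho>))) \<le> n * (4 * c / \<bar>sin (\<psi> - \<phi>)\<bar> + 2)"
proof -
  let ?F = "E \<inter> strip \<phi> t (c * \<rho>) \<inter> strip \<psi> t' (c * \<rho>)"
  let ?L = "4 * c * \<rho> / \<bar>sin (\<psi> - \<phi>)\<bar>"
  have "real (card ?F) \<le> n * (?L / \<rho> + 2)"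
  proof (rule card_le_bins[where c = c and \<phi> = \<phi>])
    fix z w assume zw: "z \<in> ?F" "w \<in> ?F"
    then show 1: "\<bar>(z - w) \<bullet> dir \<phi>\<bar> \<le> 2 * c * \<rho>"
      using strip_diff[of z \<phi> t "c * \<rho>" w] by auto
    have 2: "\<bar>(z - w) \<bullet> dir \<psi>\<bar> \<le> 2 * c * \<rho>"
      using zw strip_diff[of z \<psi> t' "c * \<rho>" w] by auto
    have "\<bar>cos (\<psi> - \<phi>) * ((z - w) \<bullet> dir \<phi>)\<bar> \<le> 1 * (2 * c * \<rho>)"
      unfolding abs_mult using 1 abs_cos_le_one by (intro mult_mono) auto
    then have "\<bar>sin (\<psi> - \<phi>) * ((z - w) \<bullet> dir (\<phi> + pi / 2))\<bar> \<le> 4 * c * \<rho>"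
      using 2 unfolding inner_dir_rotate by linarith
    then show "\<bar>(z - w) \<bullet> dir (\<phi> + pi / 2)\<bar> \<le> ?L"
      using assms(4) by (simp add: abs_mult pos_le_divide_eq mult.commute)
  next
    fix z
    have "card (?F \<inter> cball z ((2 * c + 1) * \<rho>)) \<le> card (E \<inter> cball z ((2 * c + 1) * \<rho>))"
      using assms(1) by (intro card_mono) auto
    then show "real (card (?F \<inter> cball z ((2 * c + 1) * \<rho>))) \<le> n"
      using loc[of z] by simp
  qed (use assms in auto)
  then show ?thesis using assms(2) by simp
qed

text \<open>This serves the diagonal terms, where no second strip limits the length and the diameter
  \<open>2 * B\<close> of the ball takes over.\<close>

lemma card_strip_le:
  fixes E :: "(real ^ 2) set"
  assumes "finite E" "0 < \<rho>" "0 \<le> c" "E \<subseteq> cball 0 B" "0 \<le> B"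
    and loc: "\<And>z. real (card (E \<inter> cball z ((2 * c + 1) * \<rho>))) \<le> n"
  shows "real (card (E \<inter> strip \<phi> t (c * \<rho>))) \<le> n * (2 * B / \<rho> + 2)"
proof (rule card_le_bins[where c = c and \<phi> = \<phi>])
  fix z w assume zw: "z \<in> E \<inter> strip \<phi> t (c * \<rho>)" "w \<in> E \<inter> strip \<phi> t (c * \<rho>)"
  then show "\<bar>(z - w) \<bullet> dir \<phi>\<bar> \<le> 2 * c * \<rho>"
    using strip_diff[of z \<phi> t "c * \<rho>" w] by auto
  have "norm z \<le> B" "norm w \<le> B" using zw assms(4) by auto
  then have "norm (z - w) \<le> 2 * B"
    using norm_triangle_ineq4[of z w] by linarith
  then show "\<bar>(z - w) \<bullet> dir (\<phi> + pi / 2)\<bar> \<le> 2 * B"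
    using Cauchy_Schwarz_ineq2[of "z - w" "dir (\<phi> + pi / 2)"] by simp
next
  fix z
  have "card (E \<inter> strip \<phi> t (c * \<rho>) \<inter> cball z ((2 * c + 1) * \<rho>)) \<le> card (E \<inter> cball z ((2 * c + 1) * \<rho>))"
    using assms(1) by (intro card_mono) auto
  then show "real (card (E \<inter> strip \<phi> t (c * \<rho>) \<inter> cball z ((2 * c + 1) * \<rho>))) \<le> n"
    using loc[of z] by simp
qed (use assms in auto)

section \<open>Lower bounds for the sine at equally spaced angles\<close>

lemma sin_ge_jordan:
  assumes "0 \<le> x" "x \<le> pi / 2"
  shows "2 / pi * x \<le> sin x"
proof -
  have "convex_on {0..pi} (\<lambda>x. - sin x)"
    by (rule convex_on_realI[where f' = "\<lambda>x. - cos x"])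
       (auto intro!: derivative_eq_intros cos_monotone_0_pi_le)
  \<comment> \<open>The chord of the convex function from 0 to \<open>pi / 2\<close>; the weight
    \<open>2 / pi * x\<close> places the evaluation at \<open>x\<close>.\<close>
  then have "- sin ((1 - 2 / pi * x) *\<^sub>R 0 + (2 / pi * x) *\<^sub>R (pi / 2)) \<le>
      (1 - 2 / pi * x) * (- sin 0) + (2 / pi * x) * (- sin (pi / 2))"
    using assms by (intro convex_onD) (auto simp: field_simps)
  then show ?thesis by simp
qed

text \<open>Angles between lines are taken modulo \<open>pi\<close>, so an index near
  \<open>J\<close> is as bad as one near 0, whence the minimum. Jordan's inequality treats the first
  half and the reflection at \<open>pi / 2\<close> the second.\<close>

lemma sin_pi_fraction_ge:
  fixes i J :: nat
  assumes "0 < i" "i < J"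
  shows "2 / real J * min (real i) (real (J - i)) \<le> sin (real i * pi / real J)"
proof (cases "2 * i \<le> J")
  case True
  have "2 / pi * (real i * pi / real J) \<le> sin (real i * pi / real J)"
    using True assms by (intro sin_ge_jordan) (auto simp: field_simps simp flip: of_nat_mult)
  moreover have "2 / real J * min (real i) (real (J - i)) \<le> 2 / pi * (real i * pi / real J)"
    using assms by (simp add: divide_right_mono)
  ultimately show ?thesis by linarith
next
  case False
  have "2 / pi * (real (J - i) * pi / real J) \<le> sin (real (J - i) * pi / real J)"
    using False assms by (intro sin_ge_jordan) (auto simp: field_simps of_nat_diff simp flip: of_nat_mult)
  moreover have "2 / real J * min (real i) (real (J - i)) \<le> 2 / real J * real (J - i)"
    by (intro mult_left_mono) auto
  then have "2 / real J * min (real i) (real (J - i)) \<le> 2 / pi * (real (J - i) * pi / real J)"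
    by simp
  moreover have "real (J - i) * pi / real J = pi - real i * pi / real J"
    using assms by (simp add: of_nat_diff field_simps)
  then have "sin (real (J - i) * pi / real J) = sin (real i * pi / real J)"
    by (simp only: sin_pi_minus)
  ultimately show ?thesis by linarith
qed

text \<open>The reciprocal of the minimum is bounded by the sum of both reciprocals, so that summing
  over \<open>i\<close> produces two harmonic sums.\<close>

lemma inverse_sin_pi_fraction_le:
  fixes i J :: nat
  assumes "0 < i" "i < J"
  shows "1 / sin (real i * pi / real J) \<le> real J / 2 * (1 / real i + 1 / real (J - i))"
    and "0 < sin (real i * pi / real J)"
proof -
  have p: "0 < 2 / real J * min (real i) (real (J - i))"
    using assms by simp
  then show pos: "0 < sin (real i * pi / real J)"
    using sin_pi_fraction_ge[OF assms] by linarith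
  have "1 / sin (real i * pi / real J) \<le> 1 / (2 / real J * min (real i) (real (J - i)))"
    using sin_pi_fraction_ge[OF assms] p pos assms by (intro divide_left_mono mult_pos_pos) auto
  also have "\<dots> = real J / 2 * (1 / min (real i) (real (J - i)))"
    by simp
  also have "\<dots> \<le> real J / 2 * (1 / real i + 1 / real (J - i))"
    using assms by (intro mult_left_mono) (auto simp: min_def)
  finally show "1 / sin (real i * pi / real J) \<le> real J / 2 * (1 / real i + 1 / real (J - i))" .
qed

text \<open>The sequence \<open>harm n - ln n\<close> decreases from its value 1 at
  \<open>n = 1\<close>.\<close>

lemma harm_le_ln: "0 < n \<Longrightarrow> harm n \<le> 1 + ln (real n)"
  using euler_mascheroni_sequence_decreasing[of 1 n] by (simp add: harm_expand)

section \<open>Points in many strips\<close>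

text \<open>Every distance \<open>i\<close> from \<open>j\<close> occurs at most twice, once on
  either side.\<close>

lemma sum_nat_distance_le:
  fixes f :: "nat \<Rightarrow> real"
  assumes "j < J" "\<And>i. 0 < i \<Longrightarrow> i < J \<Longrightarrow> 0 \<le> f i"
  shows "(\<Sum>k\<in>{..<J} - {j}. f (if k < j then j - k else k - j)) \<le> 2 * (\<Sum>i=1..<J. f i)"
proof -
  let ?d = "\<lambda>k. if k < j then j - k else k - j"
  have "(\<Sum>k\<in>{..<J} - {j}. f (?d k)) = (\<Sum>k\<in>{..<j} \<union> {j<..<J}. f (?d k))"
    using assms(1) by (intro sum.cong) auto
  also have "\<dots> = (\<Sum>k<j. f (?d k)) + (\<Sum>k\<in>{j<..<J}. f (?d k))"
    by (rule sum.union_disjoint) auto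
  also have "(\<Sum>k<j. f (?d k)) = (\<Sum>i\<in>{1..j}. f i)"
    by (rule sum.reindex_bij_witness[where i = "\<lambda>i. j - i" and j = "\<lambda>k. j - k"]) auto
  also have "\<dots> \<le> (\<Sum>i=1..<J. f i)"
    using assms by (intro sum_mono2) auto
  also have "(\<Sum>k\<in>{j<..<J}. f (?d k)) = (\<Sum>i\<in>{1..<J - j}. f i)"
    by (rule sum.reindex_bij_witness[where i = "\<lambda>i. i + j" and j = "\<lambda>k. k - j"]) auto
  also have "\<dots> \<le> (\<Sum>i=1..<J. f i)"
    using assms by (intro sum_mono2) auto
  finally show ?thesis by simp
qed

lemma sum_inverse_le_ln:
  assumes "0 < J"
  shows "(\<Sum>i=1..<J. 1 / real i) \<le> 1 + ln (real J)"
    and "(\<Sum>i=1..<J. 1 / real (J - i)) \<le> 1 + ln (real J)"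
proof -
  have "(\<Sum>i=1..<J. 1 / real i) \<le> harm J"
    unfolding harm_def by (simp add: inverse_eq_divide) (intro sum_mono2; auto)
  then show *: "(\<Sum>i=1..<J. 1 / real i) \<le> 1 + ln (real J)"
    using harm_le_ln[OF assms] by linarith
  have "(\<Sum>i=1..<J. 1 / real (J - i)) = (\<Sum>i=1..<J. 1 / real i)"
    by (rule sum.reindex_bij_witness[where i = "\<lambda>i. J - i" and j = "\<lambda>i. J - i"]) auto
  with * show "(\<Sum>i=1..<J. 1 / real (J - i)) \<le> 1 + ln (real J)"
    by simp
qed

text \<open>Double counting: the left sum adds up, over the points of \<open>E\<close>, the number
  of sets containing the point. Cauchy-Schwarz over \<open>E\<close> and expanding the squared
  multiplicity give the pairwise intersections.\<close>

lemma sum_card_squared_le: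
  fixes S :: "'i \<Rightarrow> 'a set"
  assumes "finite E" "finite I"
  shows "(\<Sum>j\<in>I. real (card (E \<inter> S j)))\<^sup>2
    \<le> real (card E) * (\<Sum>j\<in>I. \<Sum>k\<in>I. real (card (E \<inter> S j \<inter> S k)))"
proof -
  let ?f = "\<lambda>z. \<Sum>j\<in>I. indicator (S j) z :: real"
  have card: "real (card (E \<inter> A)) = (\<Sum>z\<in>E. indicator A z)" for A
    using assms(1) by (simp add: indicator_def sum.If_cases Int_def)
  have "(\<Sum>j\<in>I. real (card (E \<inter> S j))) = (\<Sum>z\<in>E. ?f z)"
    unfolding card by (rule sum.swap)
  also have "\<dots>\<^sup>2 \<le> (\<Sum>z\<in>E. (?f z)\<^sup>2) * real (card E)"
    by (rule sum_squared_le_sum_of_squares)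
  also have "(\<Sum>z\<in>E. (?f z)\<^sup>2) = (\<Sum>z\<in>E. \<Sum>j\<in>I. \<Sum>k\<in>I. indicator (S j \<inter> S k) z)"
    by (simp add: power2_eq_square sum_product indicator_inter_arith)
  also have "\<dots> = (\<Sum>j\<in>I. \<Sum>z\<in>E. \<Sum>k\<in>I. indicator (S j \<inter> S k) z)"
    by (rule sum.swap)
  also have "\<dots> = (\<Sum>j\<in>I. \<Sum>k\<in>I. \<Sum>z\<in>E. indicator (S j \<inter> S k) z)"
    by (intro sum.cong refl sum.swap)
  also have "\<dots> = (\<Sum>j\<in>I. \<Sum>k\<in>I. real (card (E \<inter> S j \<inter> S k)))"
    unfolding card[symmetric] by (simp add: Int_assoc)
  finally show ?thesis by (simp add: mult.commute)
qed

text \<open>A discrete form of Cordoba's $L^2$ estimate for the Kakeya maximal function in the plane.\<close>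

lemma sum_card_strips_le:
  fixes E :: "(real ^ 2) set" and J :: nat
  assumes "finite E" "0 \<le> c" "0 \<le> B" "E \<subseteq> cball 0 B" "0 < J" "I \<subseteq> {..<J}"
    and loc: "\<And>z. real (card (E \<inter> cball z ((2 * c + 1) / real J))) \<le> n"
  shows "(\<Sum>j\<in>I. real (card (E \<inter> strip (real j * pi / real J) (t j) (c / real J))))\<^sup>2
    \<le> real (card E) * (n * (2 * B + 8 * c + 4) * (real J)\<^sup>2 * (1 + ln (real J)))"
proof -
  define \<phi> where "\<phi> j = real j * pi / real J" for j
  define S where "S j = strip (\<phi> j) (t j) (c / real J)" for j
  define d where "d j k = (if k < j then j - k else k - j)" for j k :: nat
  have fin: "finite I" using assms(6) finite_subset by blast
  have n: "0 \<le> n" using loc[of 0] by (rule order_trans[rotated]) simp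
  have J: "1 \<le> real J" "0 \<le> ln (real J)" using assms(5) by auto
  have diag: "real (card (E \<inter> S j \<inter> S j)) \<le> n * (2 * B * real J + 2)" for j
    using card_strip_le[of E "1 / real J" c B n "\<phi> j" "t j"] assms by (simp add: S_def Int_assoc)
  have off: "real (card (E \<inter> S j \<inter> S k))
      \<le> n * (2 * c * real J * (1 / real (d j k) + 1 / real (J - d j k)) + 2)"
    if jk: "j < J" "k < J" "j \<noteq> k" for j k
  proof -
    define i where "i = d j k"
    have i: "0 < i" "i < J" using jk by (auto simp: i_def d_def)
    \<comment> \<open>Only the absolute value of the sine matters, so the order of \<open>j\<close>
      and \<open>k\<close> is immaterial.\<close>
    have "real k - real j = real i \<or> real k - real j = - real i"
      by (auto simp: i_def d_def of_nat_diff)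
    then have "\<phi> k - \<phi> j = real i * pi / real J \<or> \<phi> k - \<phi> j = - (real i * pi / real J)"
      unfolding \<phi>_def by (metis diff_divide_distrib left_diff_distrib minus_divide_left minus_mult_left)
    then have s: "\<bar>sin (\<phi> k - \<phi> j)\<bar> = sin (real i * pi / real J)"
      using inverse_sin_pi_fraction_le(2)[OF i] by auto
    then have "sin (\<phi> k - \<phi> j) \<noteq> 0" using inverse_sin_pi_fraction_le(2)[OF i] by auto
    then have "real (card (E \<inter> S j \<inter> S k)) \<le> n * (4 * c / \<bar>sin (\<phi> k - \<phi> j)\<bar> + 2)"
      using card_strip_Int_le[of E "1 / real J" c "\<phi> k" "\<phi> j" n "t j" "t k"] assms by (simp add: S_def)
    also have "\<dots> = n * (4 * c * (1 / sin (real i * pi / real J)) + 2)"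
      by (simp add: s)
    also have "\<dots> \<le> n * (4 * c * (real J / 2 * (1 / real i + 1 / real (J - i))) + 2)"
      using n assms(2) inverse_sin_pi_fraction_le(1)[OF i]
      by (intro mult_left_mono add_right_mono) auto
    finally show ?thesis by (simp add: i_def mult.assoc)
  qed
  have row: "(\<Sum>k<J. real (card (E \<inter> S j \<inter> S k))) \<le> n * (2 * B + 8 * c + 4) * real J * (1 + ln (real J))"
    if j: "j < J" for j
  proof -
    have "(\<Sum>k<J. real (card (E \<inter> S j \<inter> S k)))
        = real (card (E \<inter> S j \<inter> S j)) + (\<Sum>k\<in>{..<J} - {j}. real (card (E \<inter> S j \<inter> S k)))"
      using j by (intro sum.remove) auto
    also have "(\<Sum>k\<in>{..<J} - {j}. real (card (E \<inter> S j \<inter> S k)))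
        \<le> (\<Sum>k\<in>{..<J} - {j}. n * (2 * c * real J * (1 / real (d j k) + 1 / real (J - d j k)) + 2))"
      using off j by (intro sum_mono) auto
    also have "\<dots> \<le> 2 * (\<Sum>i=1..<J. n * (2 * c * real J * (1 / real i + 1 / real (J - i)) + 2))"
      unfolding d_def using j n assms(2) by (intro sum_nat_distance_le) auto
    also have "(\<Sum>i=1..<J. n * (2 * c * real J * (1 / real i + 1 / real (J - i)) + 2))
        = n * (2 * c * real J * ((\<Sum>i=1..<J. 1 / real i) + (\<Sum>i=1..<J. 1 / real (J - i))) + 2 * (real J - 1))"
      using J by (simp add: sum.distrib of_nat_diff flip: sum_distrib_left)
    also have "\<dots> \<le> n * (2 * c * real J * ((1 + ln (real J)) + (1 + ln (real J))) + 2 * (real J - 1))"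
      using sum_inverse_le_ln[OF assms(5)] n assms(2) by (intro mult_left_mono add_mono) auto
    finally have "(\<Sum>k<J. real (card (E \<inter> S j \<inter> S k)))
        \<le> n * (2 * B * real J + 2) + 2 * (n * (2 * c * real J * ((1 + ln (real J)) + (1 + ln (real J))) + 2 * (real J - 1)))"
      using diag[of j] by linarith
    also have "\<dots> = n * (2 * B * real J + 4 * real J - 2 + 8 * c * real J * (1 + ln (real J)))"
      by (simp add: algebra_simps)
    \<comment> \<open>Since \<open>1 + ln (real J)\<close> is at least 1, it may multiply the
      diagonal and rounding terms too, which gives the row bound a single product form.\<close>
    also have "\<dots> \<le> n * ((2 * B * real J + 4 * real J) * (1 + ln (real J)) + 8 * c * real J * (1 + ln (real J)))"
    proof (intro mult_left_mono add_right_mono n)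
      have "(2 * B * real J + 4 * real J) * 1 \<le> (2 * B * real J + 4 * real J) * (1 + ln (real J))"
        using J assms(3) by (intro mult_left_mono) auto
      then show "2 * B * real J + 4 * real J - 2 \<le> (2 * B * real J + 4 * real J) * (1 + ln (real J))"
        by simp
    qed
    finally show ?thesis by (simp add: algebra_simps)
  qed
  have "(\<Sum>j\<in>I. \<Sum>k\<in>I. real (card (E \<inter> S j \<inter> S k))) \<le> (\<Sum>j\<in>I. \<Sum>k<J. real (card (E \<inter> S j \<inter> S k)))"
    using assms(6) by (intro sum_mono sum_mono2) auto
  also have "\<dots> \<le> (\<Sum>j<J. \<Sum>k<J. real (card (E \<inter> S j \<inter> S k)))"
    using assms(6) by (intro sum_mono2) (auto intro: sum_nonneg)
  also have "\<dots> \<le> (\<Sum>j<J. n * (2 * B + 8 * c + 4) * real J * (1 + ln (real J)))"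
    using row by (intro sum_mono) auto
  also have "\<dots> = n * (2 * B + 8 * c + 4) * (real J)\<^sup>2 * (1 + ln (real J))"
    by (simp add: power2_eq_square)
  finally have "real (card E) * (\<Sum>j\<in>I. \<Sum>k\<in>I. real (card (E \<inter> S j \<inter> S k)))
      \<le> real (card E) * (n * (2 * B + 8 * c + 4) * (real J)\<^sup>2 * (1 + ln (real J)))"
    by (intro mult_left_mono) auto
  with sum_card_squared_le[OF assms(1) fin, of S]
  show ?thesis unfolding S_def \<phi>_def by linarith
qed

text \<open>A Chebyshev argument: each heavy direction contributes more than the square root of the
  threshold to the sum of strip counts. Squaring and applying \<open>sum_card_strips_le\<close>
  bounds the number of such directions; the factor \<open>card E * n\<close> cancels, while the
  constant \<open>k\<close> stays outside the threshold.\<close>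

lemma card_heavy_directions_le:
  fixes E :: "(real ^ 2) set" and J :: nat
  assumes "finite E" "0 \<le> c" "0 \<le> B" "E \<subseteq> cball 0 B" "0 < J" "0 \<le> \<epsilon>"
    and loc: "\<And>z. real (card (E \<inter> cball z ((2 * c + 1) / real J))) \<le> k * n"
    and "0 \<le> k" "0 < n"
  defines "I \<equiv> {j. j < J \<and> (\<exists>t. real (card E) * n * real J powr (2 * \<epsilon>) <
      (real (card (E \<inter> strip (real j * pi / real J) t (c / real J))))\<^sup>2)}"
  shows "(real (card I))\<^sup>2 \<le> k * (2 * B + 8 * c + 4) * (1 + ln (real J)) * real J powr (2 - 2 * \<epsilon>)"
proof (cases "E = {}")
  case True
  \<comment> \<open>For empty \<open>E\<close> both sides of the strict inequality defining
    \<open>I\<close> vanish, so \<open>I\<close> is empty.\<close>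
  then show ?thesis using assms(2,3,5,8) by (simp add: I_def)
next
  case False
  then have E: "0 < real (card E)" using assms(1) by (simp add: card_gt_0_iff)
  let ?L = "real (card E) * n * real J powr (2 * \<epsilon>)"
  let ?c = "\<lambda>j t. real (card (E \<inter> strip (real j * pi / real J) t (c / real J)))"
  have "\<forall>j\<in>I. \<exists>t. ?L < (?c j t)\<^sup>2"
    by (auto simp: I_def)
  then obtain t where t: "\<And>j. j \<in> I \<Longrightarrow> ?L < (?c j (t j))\<^sup>2"
    by metis
  have pos: "0 < ?L" using E assms(5,9) by simp
  have "real (card I) * sqrt ?L = (\<Sum>j\<in>I. sqrt ?L)" by simp
  also have "\<dots> \<le> (\<Sum>j\<in>I. ?c j (t j))"
    using t by (intro sum_mono real_le_lsqrt) (auto simp: less_imp_le)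
  finally have "(real (card I) * sqrt ?L)\<^sup>2 \<le> (\<Sum>j\<in>I. ?c j (t j))\<^sup>2"
    using pos by (intro power_mono mult_nonneg_nonneg) auto
  also have "\<dots> \<le> real (card E) * (k * n * (2 * B + 8 * c + 4) * (real J)\<^sup>2 * (1 + ln (real J)))"
    using assms by (intro sum_card_strips_le) (auto simp: I_def)
  finally have "(real (card I))\<^sup>2 * ?L \<le> real (card E) * (k * n * (2 * B + 8 * c + 4) * (real J)\<^sup>2 * (1 + ln (real J)))"
    using pos by (simp add: power_mult_distrib)
  \<comment> \<open>The first factor completes \<open>?L\<close> on the right, which can then be
    cancelled.\<close>
  also have "(real J)\<^sup>2 = real J powr (2 * \<epsilon>) * real J powr (2 - 2 * \<epsilon>)"
    using assms(5) by (simp flip: powr_add)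
  finally have "(real (card I))\<^sup>2 * ?L \<le> (k * (2 * B + 8 * c + 4) * (1 + ln (real J)) * real J powr (2 - 2 * \<epsilon>)) * ?L"
    by (simp only: mult_ac)
  then show ?thesis using pos by (rule mult_right_le_imp_le)
qed

section \<open>Lines and arcs of lines\<close>

definition line :: "real \<Rightarrow> (real ^ 2) set" where
  "line \<phi> = span {dir \<phi>}"

lemma dir_nonzero [simp]: "dir \<phi> \<noteq> 0"
  using norm_dir[of \<phi>] by (auto simp del: norm_dir)

lemma line_in_grassmannian: "line \<phi> \<in> grassmannian 1"
  unfolding line_def by (rule span1_in_grassmannian) simp

lemma grassmannian1_obtain_line:
  assumes "V \<in> grassmannian 1"
  obtains \<phi> where "V = line \<phi>"
proof -
  have V: "subspace V" "dim V = 1" using assms by (auto simp: grassmannian_def)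
  then have "V \<noteq> {0}" by auto
  then obtain x where x: "x \<in> V" "x \<noteq> 0" using V(1) subspace_0 by blast
  have sub: "span {x} \<subseteq> V" using x V(1) by (simp add: span_minimal)
  have "dim (span {x}) = 1" using x(2) by (simp add: dim_eq_card_independent)
  then have eq: "span {x} = V"
    using V sub by (intro subspace_dim_equal) auto
  define y where "y = sgn x"
  have "norm y = 1" using x(2) by (simp add: y_def norm_sgn)
  then have "(y $ 1)\<^sup>2 + (y $ 2)\<^sup>2 = 1"
    by (simp add: norm_vec_def L2_set_def sum_2 real_sqrt_eq_1_iff)
  then obtain \<phi> where "y $ 1 = cos \<phi>" "y $ 2 = sin \<phi>"
    by (metis sincos_total_2pi)
  then have "y = dir \<phi>"
    by (simp add: vec_eq_iff forall_2 dir_def)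
  then have "V = line \<phi>"
    using eq span_sgn[OF x(2)] by (simp add: line_def y_def)
  then show thesis using that by blast
qed

lemma orth_proj_line: "orth_proj (line \<phi>) x = (x \<bullet> dir \<phi>) *\<^sub>R dir \<phi>"
  unfolding line_def by (rule orth_proj_span1) simp

lemma norm_diff_orth_proj_line: "norm (dir \<phi> - orth_proj (line \<psi>) (dir \<phi>)) = \<bar>sin (\<psi> - \<phi>)\<bar>"
proof -
  have "(norm (dir \<phi> - orth_proj (line \<psi>) (dir \<phi>)))\<^sup>2 = (sin (\<psi> - \<phi>))\<^sup>2"
  proof -
    have "(norm (dir \<phi> - orth_proj (line \<psi>) (dir \<phi>)))\<^sup>2 = 1 - (cos (\<psi> - \<phi>))\<^sup>2"
      unfolding power2_norm_eq_inner orth_proj_line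
      by (simp add: inner_diff inner_dir_dir cos_minus power2_eq_square cos_diff[of \<phi> \<psi>] cos_diff[of \<psi> \<phi>] algebra_simps)
    then show ?thesis by (simp add: sin_squared_eq)
  qed
  then have "(norm (dir \<phi> - orth_proj (line \<psi>) (dir \<phi>)))\<^sup>2 = \<bar>sin (\<psi> - \<phi>)\<bar>\<^sup>2"
    by simp
  then show ?thesis by (rule power2_eq_imp_eq) auto
qed

text \<open>The norm is the distance of \<open>dir \<phi>\<close> from \<open>V\<close>, that is,
  the sine of the angle between \<open>line \<phi>\<close> and \<open>V\<close>. It requires no
  choice of an angle for \<open>V\<close> and varies continuously with \<open>V\<close>, which makes
  arcs open.\<close>

definition arc :: "real \<Rightarrow> real \<Rightarrow> (real ^ 2) set set" where
  "arc \<phi> \<delta> = {V \<in> grassmannian 1. norm (dir \<phi> - orth_proj V (dir \<phi>)) < \<delta>}"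

lemma line_in_arc: "line \<psi> \<in> arc \<phi> \<delta> \<longleftrightarrow> \<bar>sin (\<psi> - \<phi>)\<bar> < \<delta>"
  using line_in_grassmannian[of \<psi>] unfolding arc_def mem_Collect_eq norm_diff_orth_proj_line by blast

lemma arc_open: "grassmannian_open 1 (arc \<phi> \<delta>)"
  unfolding grassmannian_open_def
proof (intro conjI ballI)
  show "arc \<phi> \<delta> \<subseteq> grassmannian 1" by (auto simp: arc_def)
  fix V assume V: "V \<in> arc \<phi> \<delta>"
  let ?n = "\<lambda>V. norm (dir \<phi> - orth_proj V (dir \<phi>))"
  have Vg: "V \<in> grassmannian 1" and Vn: "?n V < \<delta>" using V by (auto simp: arc_def)
  show "\<exists>e>0. \<forall>W\<in>grassmannian 1. grassmannian_dist V W < e \<longrightarrow> W \<in> arc \<phi> \<delta>"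
  proof (intro exI[of _ "\<delta> - ?n V"] conjI ballI impI)
    show "0 < \<delta> - ?n V" using Vn by simp
    fix W :: "(real ^ 2) set"
    assume W: "W \<in> grassmannian 1" "grassmannian_dist V W < \<delta> - ?n V"
    obtain \<psi> \<psi>' where l: "V = line \<psi>" "W = line \<psi>'"
      using grassmannian1_obtain_line Vg W(1) by metis
    \<comment> \<open>Bounded linearity is what makes \<open>onorm\<close> bound the value at the
      unit vector \<open>dir \<phi>\<close>.\<close>
    have "bounded_linear (\<lambda>x. orth_proj V x - orth_proj W x)"
      unfolding l orth_proj_line by (intro bounded_linear_intros)
    from onorm[OF this, of "dir \<phi>"]
    have "norm (orth_proj V (dir \<phi>) - orth_proj W (dir \<phi>)) \<le> grassmannian_dist V W"
      by (simp add: grassmannian_dist_def)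
    moreover have "?n W \<le> ?n V + norm (orth_proj V (dir \<phi>) - orth_proj W (dir \<phi>))"
      using norm_triangle_ineq[of "dir \<phi> - orth_proj V (dir \<phi>)" "orth_proj V (dir \<phi>) - orth_proj W (dir \<phi>)"] by simp
    ultimately show "W \<in> arc \<phi> \<delta>"
      using W by (simp add: arc_def)
  qed
qed

lemma arc_measurable: "arc \<phi> \<delta> \<in> sets (grassmannian_borel 1)"
  unfolding sets_grassmannian_borel using arc_open by auto

definition rot :: "real \<Rightarrow> real ^ 2 ^ 2" where
  "rot \<phi> = vector [vector [cos \<phi>, - sin \<phi>], vector [sin \<phi>, cos \<phi>]]"

lemma rot_dir: "rot \<phi> *v dir \<psi> = dir (\<phi> + \<psi>)"
  by (simp add: vec_eq_iff forall_2 matrix_vector_mult_def sum_2 rot_def dir_def cos_add sin_add)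

lemma rotation_matrix_rot: "rotation_matrix (rot \<phi>)"
  unfolding rotation_matrix_def orthogonal_matrix_def det_2
  by (simp add: vec_eq_iff forall_2 matrix_matrix_mult_def sum_2 rot_def transpose_def mat_def
      power2_eq_square[symmetric] mult.commute)

lemma rot_line: "(*v) (rot \<phi>) ` line \<psi> = line (\<phi> + \<psi>)"
  unfolding line_def by (subst linear_span_image[symmetric]) (simp_all add: rot_dir)

lemma rot_arc: "(\<lambda>V. (*v) (rot \<eta>) ` V) ` arc \<phi> \<delta> = arc (\<phi> + \<eta>) \<delta>"
proof (intro equalityI subsetI)
  fix W assume "W \<in> (\<lambda>V. (*v) (rot \<eta>) ` V) ` arc \<phi> \<delta>"
  then obtain V where V: "V \<in> arc \<phi> \<delta>" "W = (*v) (rot \<eta>) ` V" by auto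
  then obtain \<psi> where "V = line \<psi>"
    using grassmannian1_obtain_line by (auto simp: arc_def)
  then show "W \<in> arc (\<phi> + \<eta>) \<delta>"
    using V by (simp add: rot_line line_in_arc)
next
  fix W assume W: "W \<in> arc (\<phi> + \<eta>) \<delta>"
  then obtain \<psi> where \<psi>: "W = line \<psi>"
    using grassmannian1_obtain_line by (auto simp: arc_def)
  have "line (\<psi> - \<eta>) \<in> arc \<phi> \<delta>"
    using W by (simp add: \<psi> line_in_arc algebra_simps)
  moreover have "W = (*v) (rot \<eta>) ` line (\<psi> - \<eta>)"
    by (simp add: rot_line \<psi>)
  ultimately show "W \<in> (\<lambda>V. (*v) (rot \<eta>) ` V) ` arc \<phi> \<delta>"
    by blast
qed

text \<open>The rotates of the arc by multiples of \<open>pi / m\<close> have equal measure and are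
  disjoint: a line common to two of them would force the sine of the angle between their centres
  below \<open>2 / m\<close>, against \<open>sin_pi_fraction_ge\<close>. So \<open>m\<close> equal
  measures add up to at most 1.\<close>

lemma measure_arc_le:
  assumes "rotation_invariant_prob 1 (\<gamma> :: (real ^ 2) set measure)" "0 < m"
  shows "measure \<gamma> (arc \<phi> (1 / real m)) \<le> 1 / real m"
proof -
  interpret prob_space \<gamma> using assms(1) by (simp add: rotation_invariant_prob_def)
  have sets: "arc \<phi> \<delta> \<in> sets \<gamma>" for \<phi> \<delta>
    using assms(1) arc_measurable unfolding rotation_invariant_prob_def by blast
  let ?A = "\<lambda>j. arc (\<phi> + real j * pi / real m) (1 / real m)"
  have eq: "prob (?A j) = prob (arc \<phi> (1 / real m))" for j
    using assms(1) rotation_matrix_rot sets unfolding rotation_invariant_prob_def rot_arc[symmetric] measure_def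
    by metis
  have "disjoint_family_on ?A {..<m}"
    unfolding disjoint_family_on_def
  proof (intro ballI impI, rule ccontr)
    fix j k assume jk: "j \<in> {..<m}" "k \<in> {..<m}" "j \<noteq> k" "?A j \<inter> ?A k \<noteq> {}"
    have False if jk: "j < k" "k < m" and ne: "?A j \<inter> ?A k \<noteq> {}" for j k
    proof -
      obtain V where V: "V \<in> ?A j" "V \<in> ?A k" using ne by auto
      then obtain \<psi> where \<psi>: "V = line \<psi>"
        using grassmannian1_obtain_line by (auto simp: arc_def)
      let ?a = "\<psi> - (\<phi> + real j * pi / real m)" and ?b = "\<psi> - (\<phi> + real k * pi / real m)"
      have lt: "\<bar>sin ?a\<bar> < 1 / real m" "\<bar>sin ?b\<bar> < 1 / real m"
        using V by (simp_all only: \<psi> line_in_arc)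
      have "\<bar>sin (?a - ?b)\<bar> \<le> \<bar>sin ?a * cos ?b\<bar> + \<bar>cos ?a * sin ?b\<bar>"
        unfolding sin_diff by (rule abs_triangle_ineq4)
      also have "\<dots> \<le> \<bar>sin ?a\<bar> * 1 + 1 * \<bar>sin ?b\<bar>"
        unfolding abs_mult by (intro add_mono mult_mono) auto
      finally have "\<bar>sin (?a - ?b)\<bar> < 2 / real m" using lt by simp
      moreover have "?a - ?b = real (k - j) * pi / real m"
        using jk by (simp add: of_nat_diff field_simps)
      moreover have "0 < k - j" "k - j < m" using jk by auto
      moreover have "2 / real m * 1 \<le> 2 / real m * min (real (k - j)) (real (m - (k - j)))"
        using jk by (intro mult_left_mono) auto
      then have "2 / real m \<le> sin (real (k - j) * pi / real m)"
        using sin_pi_fraction_ge[of "k - j" m] \<open>0 < k - j\<close> \<open>k - j < m\<close> by linarith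
      ultimately show False by simp
    qed
    from this[of j k] this[of k j] show False using jk by (metis Int_commute lessThan_iff nat_neq_iff)
  qed
  then have "prob (\<Union>j<m. ?A j) = (\<Sum>j<m. prob (?A j))"
    using sets by (intro finite_measure_finite_Union) auto
  also have "\<dots> = real m * prob (arc \<phi> (1 / real m))"
    by (simp add: eq)
  finally have "real m * prob (arc \<phi> (1 / real m)) \<le> 1"
    using prob_le_1 by metis
  then show ?thesis
    using assms(2) by (simp add: field_simps)
qed

text \<open>Round an angle of \<open>V\<close> down to a multiple of \<open>pi / J\<close>; reducing
  the index modulo \<open>J\<close> shifts the angle by a multiple of \<open>pi\<close>, which
  preserves the absolute sine. The rounding error is below \<open>4 / J\<close> because
  \<open>pi < 4\<close>.\<close>

lemma grassmannian1_covered_by_arcs: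
  assumes "V \<in> grassmannian 1" "0 < J"
  obtains j where "j < J" "V \<in> arc (real j * pi / real J) (4 / real J)"
proof -
  obtain \<psi> where \<psi>: "V = line \<psi>" using grassmannian1_obtain_line[OF assms(1)] by blast
  define k where "k = \<lfloor>\<psi> * real J / pi\<rfloor>"
  define q where "q = k div int J"
  define j where "j = nat (k mod int J)"
  have j: "j < J" using assms(2) by (simp add: j_def nat_less_iff)
  have "int j = k mod int J" using assms(2) by (simp add: j_def)
  then have "k = q * int J + int j" by (simp add: q_def)
  then have "real_of_int k = real_of_int q * real J + real j"
    by simp
  then have "real_of_int k * pi / real J = real j * pi / real J + real_of_int q * pi"
    using assms(2) by (simp add: add_divide_distrib distrib_right)
  then have eq: "\<psi> - real j * pi / real J = (\<psi> - real_of_int k * pi / real J) + real_of_int q * pi"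
    by simp
  define x where "x = \<psi> - real_of_int k * pi / real J"
  have s0: "sin (real_of_int q * pi) = 0"
    using sin_zero_iff_int2 by blast
  then have "\<bar>cos (real_of_int q * pi)\<bar> = 1"
    using sin_cos_squared_add[of "real_of_int q * pi"] by (auto simp: power2_eq_1_iff)
  then have "\<bar>sin (\<psi> - real j * pi / real J)\<bar> = \<bar>sin x\<bar>"
    unfolding eq x_def[symmetric] sin_add s0 by (simp add: abs_mult)
  also have "\<dots> \<le> \<bar>x\<bar>" by (rule abs_sin_x_le_abs_x)
  also have "\<bar>x\<bar> < 4 / real J"
  proof -
    have "real_of_int k \<le> \<psi> * real J / pi" "\<psi> * real J / pi < real_of_int k + 1"
      unfolding k_def by linarith+
    then have "real_of_int k * pi \<le> \<psi> * real J" "\<psi> * real J < real_of_int k * pi + pi"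
      by (simp_all add: field_simps)
    moreover have "x * real J = \<psi> * real J - real_of_int k * pi"
      using assms(2) by (simp add: x_def field_simps)
    ultimately have "\<bar>x\<bar> * real J < 4"
      using pi_less_4 by (simp add: abs_mult_pos' abs_if)
    then show ?thesis using assms(2) by (simp add: field_simps)
  qed
  finally show thesis using that[OF j] by (simp add: \<psi> line_in_arc)
qed

text \<open>The sign of the parameter \<open>t\<close> depends on which of the two unit vectors spanning the line is
  close to \<^term>\<open>dir \<phi>\<close>.\<close>

lemma arc_slab_subset_strip:
  assumes "V \<in> arc \<phi> \<delta>" "y \<in> V"
  obtains t where "\<And>z. norm z \<le> B \<Longrightarrow> dist (orth_proj V z) y \<le> w \<Longrightarrow> z \<in> strip \<phi> t (w + 2 * B * \<delta>)"
proof -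
  obtain \<psi> where \<psi>: "V = line \<psi>"
    using grassmannian1_obtain_line assms(1) by (auto simp: arc_def)
  define \<sigma> where "\<sigma> = (if 0 \<le> cos (\<psi> - \<phi>) then 1 else - 1 :: real)"
  obtain s where s: "y = s *\<^sub>R dir \<psi>"
    using assms(2) by (auto simp: \<psi> line_def span_singleton)
  have sin: "\<bar>sin (\<psi> - \<phi>)\<bar> < \<delta>" using assms(1) by (simp add: \<psi> line_in_arc)
  have \<sigma>: "\<bar>\<sigma>\<bar> = 1" "\<sigma> * cos (\<psi> - \<phi>) = \<bar>cos (\<psi> - \<phi>)\<bar>" "\<sigma>\<^sup>2 = 1" by (auto simp: \<sigma>_def)
  have near: "norm (\<sigma> *\<^sub>R dir \<psi> - dir \<phi>) \<le> 2 * \<delta>"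
  proof -
    have "(norm (\<sigma> *\<^sub>R dir \<psi> - dir \<phi>))\<^sup>2 = 2 - 2 * \<bar>cos (\<psi> - \<phi>)\<bar>"
      using \<sigma>(2,3) cos_minus[of "\<psi> - \<phi>"] unfolding power2_norm_eq_inner
      by (simp add: inner_diff inner_dir_dir inner_commute[of "dir \<phi>" "dir \<psi>"] power2_eq_square algebra_simps)
    \<comment> \<open>A number in [0,1] is at least its square; this passes from the cosine to the
      sine, the quantity that \<open>arc\<close> controls.\<close>
    also have "\<dots> \<le> 2 - 2 * (cos (\<psi> - \<phi>))\<^sup>2"
      using abs_cos_le_one[of "\<psi> - \<phi>"] power_le_one[of "\<bar>cos (\<psi> - \<phi>)\<bar>" 2]
        mult_left_le_one_le[of "\<bar>cos (\<psi> - \<phi>)\<bar>" "\<bar>cos (\<psi> - \<phi>)\<bar>"]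
      by (simp add: power2_eq_square)
    also have "\<dots> = 2 * (sin (\<psi> - \<phi>))\<^sup>2" by (simp add: sin_squared_eq)
    also have "\<dots> \<le> (2 * \<bar>sin (\<psi> - \<phi>)\<bar>)\<^sup>2" by (simp add: power_mult_distrib)
    finally have "norm (\<sigma> *\<^sub>R dir \<psi> - dir \<phi>) \<le> 2 * \<bar>sin (\<psi> - \<phi>)\<bar>"
      by (rule power2_le_imp_le) simp
    then show ?thesis using sin by linarith
  qed
  have "z \<in> strip \<phi> (\<sigma> * s) (w + 2 * B * \<delta>)" if z: "norm z \<le> B" "dist (orth_proj V z) y \<le> w" for z
  proof -
    have "orth_proj V z - y = (z \<bullet> dir \<psi> - s) *\<^sub>R dir \<psi>"
      by (simp add: \<psi> orth_proj_line s scaleR_left_diff_distrib)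
    then have 1: "\<bar>z \<bullet> dir \<psi> - s\<bar> \<le> w" using z(2) by (simp add: dist_norm)
    have "\<bar>z \<bullet> (\<sigma> *\<^sub>R dir \<psi> - dir \<phi>)\<bar> \<le> norm z * norm (\<sigma> *\<^sub>R dir \<psi> - dir \<phi>)"
      by (rule Cauchy_Schwarz_ineq2)
    also have "\<dots> \<le> B * (2 * \<delta>)"
      using z(1) near by (intro mult_mono) (auto intro: order_trans[OF norm_ge_zero])
    finally have 2: "\<bar>z \<bullet> (\<sigma> *\<^sub>R dir \<psi> - dir \<phi>)\<bar> \<le> 2 * B * \<delta>" by simp
    \<comment> \<open>The first term is the error within \<open>V\<close>, of size at most
      \<open>w\<close>; the second comes from the tilt of \<open>V\<close> against
      \<open>line \<phi>\<close>.\<close>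
    have "z \<bullet> dir \<phi> - \<sigma> * s = \<sigma> * (z \<bullet> dir \<psi> - s) - z \<bullet> (\<sigma> *\<^sub>R dir \<psi> - dir \<phi>)"
      by (simp add: inner_diff_right algebra_simps)
    moreover have "\<bar>\<sigma> * (z \<bullet> dir \<psi> - s)\<bar> \<le> w"
      using 1 \<sigma>(1) by (simp add: abs_mult)
    ultimately show ?thesis
      using 2 unfolding strip_def mem_Collect_eq by linarith
  qed
  then show thesis using that by blast
qed

section \<open>Exceptional directions\<close>

lemma dist_orth_proj_le:
  fixes V :: "(real ^ 2) set"
  assumes "V \<in> grassmannian 1"
  shows "dist (orth_proj V x) (orth_proj V y) \<le> dist x y"
proof -
  obtain \<psi> where \<psi>: "V = line \<psi>" using grassmannian1_obtain_line[OF assms] by blast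
  have "orth_proj V x - orth_proj V y = ((x - y) \<bullet> dir \<psi>) *\<^sub>R dir \<psi>"
    by (simp add: \<psi> orth_proj_line inner_diff_left scaleR_left_diff_distrib)
  then show ?thesis
    using Cauchy_Schwarz_ineq2[of "x - y" "dir \<psi>"] by (simp add: dist_norm)
qed

lemma bounded_orth_proj_image:
  fixes V :: "(real ^ 2) set"
  assumes "V \<in> grassmannian 1" "bounded X"
  shows "bounded (orth_proj V ` X)"
proof -
  obtain x e where "\<And>y. y \<in> X \<Longrightarrow> dist x y \<le> e" using assms(2) by (auto simp: bounded_def)
  then have "\<And>y. y \<in> X \<Longrightarrow> dist (orth_proj V x) (orth_proj V y) \<le> e"
    using dist_orth_proj_le[OF assms(1)] order_trans by blast
  then show ?thesis unfolding bounded_def by blast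
qed

text \<open>The estimate at the single scale \<open>1 / (4 * m)\<close>. The set \<open>A\<close>
  consists of arcs about the heavy directions. A line outside \<open>A\<close> is close to a
  direction that is not heavy; the centres relevant to a piece of the projection lie in one strip of
  that direction, and their projections cover the piece. The radius is doubled to leave room for the
  scales between consecutive powers of 2.\<close>

lemma exceptional_directions:
  fixes X :: "(real ^ 2) set" and \<gamma> :: "(real ^ 2) set measure"
  assumes \<gamma>: "rotation_invariant_prob 1 \<gamma>" and X: "bounded X"
  obtains K where
    "\<And>m r n \<epsilon>. 0 < m \<Longrightarrow> 0 < r \<Longrightarrow> r \<le> 1 / real (4 * m) \<Longrightarrow> 0 \<le> \<epsilon> \<Longrightarrow> 0 < n \<Longrightarrow>
      (\<And>x. x \<in> X \<Longrightarrow> real (covering_number r (X \<inter> cball x (1 / real (4 * m)))) \<le> n) \<Longrightarrow>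
      \<exists>A\<in>sets \<gamma>. measure \<gamma> A \<le> K * sqrt (1 + ln (real (4 * m))) * real (4 * m) powr (- \<epsilon>) \<and>
        (\<forall>V\<in>grassmannian 1 - A. \<forall>y\<in>V.
          (real (covering_number r (orth_proj V ` X \<inter> cball y (2 / real (4 * m)))))\<^sup>2
            \<le> real (covering_number r X) * n * real (4 * m) powr (2 * \<epsilon>))"
proof -
  interpret prob_space \<gamma> using \<gamma> by (simp add: rotation_invariant_prob_def)
  obtain b where b: "0 < b" "\<And>x. x \<in> X \<Longrightarrow> norm x \<le> b"
    using X bounded_pos by metis
  \<comment> \<open>Cover centres lie within \<open>r \<le> 1\<close> of \<open>X\<close>, hence in
    \<open>cball 0 B\<close>. In \<open>c\<close>, the 3 is the slab width \<open>2 / J\<close> plus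
    \<open>r\<close>, and \<open>8 * B\<close> is the tilt over an arc of radius
    \<open>4 / J\<close>; both are in units of \<open>1 / J\<close>. The scale
    \<open>2 * c + 2\<close> is the radius \<open>2 * c + 1\<close> of the strip lemmas enlarged by
    \<open>r\<close>.\<close>
  define B where "B = b + 1"
  define c where "c = 3 + 8 * B"
  have B: "0 \<le> B" "0 \<le> c" "0 \<le> 2 * c + 2" using b(1) by (auto simp: B_def c_def)
  obtain k :: nat where k:
    "\<And>(X :: (real ^ 2) set) z R r n. bounded X \<Longrightarrow> 0 < R \<Longrightarrow> 0 < r \<Longrightarrow>
      (\<And>x. x \<in> X \<Longrightarrow> real (covering_number r (X \<inter> cball x R)) \<le> n) \<Longrightarrow> 0 \<le> n \<Longrightarrow>
      real (covering_number r (X \<inter> cball z ((2 * c + 2) * R))) \<le> real k * n"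
    using covering_number_cball_scale[OF B(3), where 'a = "real ^ 2"] by blast
  define M where "M = real k * (2 * B + 8 * c + 4)"
  have M: "0 \<le> M" using B by (simp add: M_def)
  have "\<exists>A\<in>sets \<gamma>. measure \<gamma> A \<le> 4 * sqrt M * sqrt (1 + ln (real (4 * m))) * real (4 * m) powr (- \<epsilon>) \<and>
        (\<forall>V\<in>grassmannian 1 - A. \<forall>y\<in>V.
          (real (covering_number r (orth_proj V ` X \<inter> cball y (2 / real (4 * m)))))\<^sup>2
            \<le> real (covering_number r X) * n * real (4 * m) powr (2 * \<epsilon>))"
    if m: "0 < m" and r: "0 < r" "r \<le> 1 / real (4 * m)" and \<epsilon>: "0 \<le> \<epsilon>" and n: "0 < n"
      and loc: "\<And>x. x \<in> X \<Longrightarrow> real (covering_number r (X \<inter> cball x (1 / real (4 * m)))) \<le> n"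
    for m r n \<epsilon>
  proof -
    \<comment> \<open>With this choice the radius \<open>4 / J\<close> of the covering arcs is the
      radius \<open>1 / m\<close> whose measure is known.\<close>
    define J where "J = 4 * m"
    have J: "0 < J" "1 \<le> real J" "1 / real m = 4 / real J" using m by (auto simp: J_def)
    have r1: "r \<le> 1 / real J" using r by (simp add: J_def)
    obtain E where E: "finite E" "card E = covering_number r X" "X \<subseteq> (\<Union>c\<in>E. cball c r)"
      "\<forall>c\<in>E. \<exists>x\<in>X. dist c x \<le> r"
      "\<forall>z \<rho>. card (E \<inter> cball z \<rho>) \<le> covering_number r (X \<inter> cball z (\<rho> + r))"
      by (rule minimal_cover[OF X r(1)])
    have EB: "E \<subseteq> cball 0 B"
    proof
      fix e assume "e \<in> E"
      then obtain x where x: "x \<in> X" "dist e x \<le> r" using E(4) by blast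
      have "1 / real J \<le> 1" using J by simp
      then have "dist e x \<le> 1" using x r1 by linarith
      then show "e \<in> cball 0 B"
        using b(2)[OF x(1)] norm_triangle_sub[of e x] by (simp add: B_def dist_norm)
    qed
    have Eloc: "real (card (E \<inter> cball z ((2 * c + 1) / real J))) \<le> real k * n" for z
    proof -
      have "card (E \<inter> cball z ((2 * c + 1) / real J)) \<le> covering_number r (X \<inter> cball z ((2 * c + 1) / real J + r))"
        by (rule E(5)[rule_format])
      also have "\<dots> \<le> covering_number r (X \<inter> cball z ((2 * c + 2) * (1 / real J)))"
      proof (rule covering_number_mono)
        have "(2 * c + 1) / real J + r \<le> (2 * c + 2) * (1 / real J)"
          using r1 by (simp add: add_divide_distrib)
        then show "X \<inter> cball z ((2 * c + 1) / real J + r) \<subseteq> X \<inter> cball z ((2 * c + 2) * (1 / real J))"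
          by (intro Int_mono cball_subset_cball_iff[THEN iffD2]) auto
      qed (use X r in auto)
      finally have "real (card (E \<inter> cball z ((2 * c + 1) / real J)))
          \<le> real (covering_number r (X \<inter> cball z ((2 * c + 2) * (1 / real J))))" by simp
      also have "\<dots> \<le> real k * n"
        using loc J n r X by (intro k) (auto simp: J_def)
      finally show ?thesis .
    qed
    define I where "I = {j. j < J \<and> (\<exists>t. real (card E) * n * real J powr (2 * \<epsilon>) <
      (real (card (E \<inter> strip (real j * pi / real J) t (c / real J))))\<^sup>2)}"
    have "(real (card I))\<^sup>2 \<le> M * (1 + ln (real J)) * real J powr (2 - 2 * \<epsilon>)"
      unfolding I_def M_def
      by (rule card_heavy_directions_le) (use E(1) B EB J \<epsilon> Eloc n in auto)
    also have "\<dots> = M * (1 + ln (real J)) * (real J powr (1 - \<epsilon>))\<^sup>2"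
      by (simp add: power2_eq_square algebra_simps flip: powr_add)
    finally have "real (card I) \<le> sqrt (M * (1 + ln (real J)) * (real J powr (1 - \<epsilon>))\<^sup>2)"
      by (rule real_le_rsqrt)
    also have "\<dots> = sqrt M * sqrt (1 + ln (real J)) * real J powr (1 - \<epsilon>)"
      by (simp add: real_sqrt_mult)
    finally have cardI: "real (card I) \<le> sqrt M * sqrt (1 + ln (real J)) * real J powr (1 - \<epsilon>)" .
    define A where "A = (\<Union>j\<in>I. arc (real j * pi / real J) (1 / real m))"
    have finI: "finite I" by (simp add: I_def)
    have arcs: "arc \<phi> \<delta> \<in> sets \<gamma>" for \<phi> \<delta>
      using \<gamma> arc_measurable unfolding rotation_invariant_prob_def by blast
    have "measure \<gamma> A \<le> (\<Sum>j\<in>I. measure \<gamma> (arc (real j * pi / real J) (1 / real m)))"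
      unfolding A_def using arcs finI by (intro measure_UNION_le) auto
    also have "\<dots> \<le> (\<Sum>j\<in>I. 1 / real m)"
      using measure_arc_le[OF \<gamma> m] by (intro sum_mono)
    also have "\<dots> = real (card I) * (4 / real J)" by (simp add: J(3)[symmetric])
    also have "\<dots> \<le> (sqrt M * sqrt (1 + ln (real J)) * real J powr (1 - \<epsilon>)) * (4 / real J)"
      using cardI by (intro mult_right_mono) auto
    also have "\<dots> = 4 * sqrt M * sqrt (1 + ln (real J)) * real J powr (- \<epsilon>)"
      using J by (simp add: powr_diff powr_minus field_simps)
    finally have "measure \<gamma> A \<le> 4 * sqrt M * sqrt (1 + ln (real J)) * real J powr (- \<epsilon>)" .
    moreover have "A \<in> sets \<gamma>" unfolding A_def using arcs finI by auto
    moreover have "(real (covering_number r (orth_proj V ` X \<inter> cball y (2 / real J))))\<^sup>2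
            \<le> real (covering_number r X) * n * real J powr (2 * \<epsilon>)"
      if V: "V \<in> grassmannian 1" "V \<notin> A" and y: "y \<in> V" for V y
    proof -
      obtain j where j: "j < J" "V \<in> arc (real j * pi / real J) (4 / real J)"
        by (rule grassmannian1_covered_by_arcs[OF V(1) J(1)])
      then have jI: "j \<notin> I" using V(2) J(3) by (auto simp: A_def)
      obtain t where t: "\<And>z. norm z \<le> B \<Longrightarrow> dist (orth_proj V z) y \<le> 3 / real J \<Longrightarrow>
          z \<in> strip (real j * pi / real J) t (3 / real J + 2 * B * (4 / real J))"
        using arc_slab_subset_strip[OF j(2) y, of B "3 / real J"] by blast
      have ceq: "3 / real J + 2 * B * (4 / real J) = c / real J"
        by (simp add: c_def add_divide_distrib)
      let ?S = "E \<inter> strip (real j * pi / real J) t (c / real J)"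
      have "orth_proj V ` X \<inter> cball y (2 / real J) \<subseteq> (\<Union>p\<in>orth_proj V ` ?S. cball p r)"
      proof
        fix p assume p: "p \<in> orth_proj V ` X \<inter> cball y (2 / real J)"
        then obtain x where x: "x \<in> X" "p = orth_proj V x" by auto
        then obtain e where e: "e \<in> E" "dist e x \<le> r" using E(3) by auto
        have 1: "dist (orth_proj V e) p \<le> r"
          using dist_orth_proj_le[OF V(1), of e x] e(2) x(2) by simp
        have "dist (orth_proj V e) y \<le> r + 2 / real J"
          using 1 p dist_triangle[of "orth_proj V e" y p] by (auto simp: dist_commute)
        \<comment> \<open>Since \<open>r \<le> 1 / J\<close>, every covering centre projects into
          the slab that \<open>t\<close> encloses in the strip.\<close>
        also have "\<dots> \<le> 3 / real J" using r1 by simp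
        finally have "e \<in> ?S"
          using t[of e] e(1) EB ceq by auto
        then show "p \<in> (\<Union>p\<in>orth_proj V ` ?S. cball p r)"
          using 1 by auto
      qed
      then have "covering_number r (orth_proj V ` X \<inter> cball y (2 / real J)) \<le> card (orth_proj V ` ?S)"
        using E(1) by (intro covering_number_le) auto
      also have "\<dots> \<le> card ?S" using E(1) by (intro card_image_le) auto
      finally have "(real (covering_number r (orth_proj V ` X \<inter> cball y (2 / real J))))\<^sup>2 \<le> (real (card ?S))\<^sup>2"
        by (intro power_mono) auto
      also have "\<dots> \<le> real (card E) * n * real J powr (2 * \<epsilon>)"
        using jI j(1) unfolding I_def by (auto simp: not_less)
      finally show ?thesis using E(2) by simp
    qed
    ultimately show ?thesis unfolding J_def by blast
  qed
  then show thesis by (rule that)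
qed

section \<open>Almost every direction: dyadic scales and Borel-Cantelli\<close>

text \<open>With exponents for \<open>X\<close> fixed, the exceptional sets at the scales
  \<open>1 / J i\<close> have summable measure. Almost every \<open>V\<close> thus avoids them from
  some index \<open>N\<close> on; intermediate radii are compared with dyadic ones, and the large
  radii are absorbed into the constant.\<close>

lemma AE_assouad_spectrum_orth_proj_le:
  fixes X :: "(real ^ 2) set" and \<gamma> :: "(real ^ 2) set measure"
  assumes \<gamma>: "rotation_invariant_prob 1 \<gamma>" and X: "bounded X" and \<theta>: "0 < \<theta>" "\<theta> < 1"
    and \<alpha>: "0 \<le> \<alpha>" "0 < C"
      "\<And>R x. 0 < R \<Longrightarrow> R < 1 \<Longrightarrow> x \<in> X \<Longrightarrow>
        real (covering_number (R powr (1 / \<theta>)) (X \<inter> cball x R)) \<le> C * (R / R powr (1 / \<theta>)) powr \<alpha>"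
    and d: "0 \<le> d" "0 < r0" "\<And>r. 0 < r \<Longrightarrow> r < r0 \<Longrightarrow> real (covering_number r X) \<le> r powr (- d)"
    and \<epsilon>: "0 < \<epsilon>"
  shows "AE V in \<gamma>. assouad_spectrum \<theta> (orth_proj V ` X) \<le> ereal ((d / (1 - \<theta>) + \<alpha>) / 2 + \<epsilon>)"
proof -
  interpret prob_space \<gamma> using \<gamma> by (simp add: rotation_invariant_prob_def)
  obtain K where K:
    "\<And>m r n \<epsilon>. 0 < m \<Longrightarrow> 0 < r \<Longrightarrow> r \<le> 1 / real (4 * m) \<Longrightarrow> 0 \<le> \<epsilon> \<Longrightarrow> 0 < n \<Longrightarrow>
      (\<And>x. x \<in> X \<Longrightarrow> real (covering_number r (X \<inter> cball x (1 / real (4 * m)))) \<le> n) \<Longrightarrow>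
      \<exists>A\<in>sets \<gamma>. measure \<gamma> A \<le> K * sqrt (1 + ln (real (4 * m))) * real (4 * m) powr (- \<epsilon>) \<and>
        (\<forall>V\<in>grassmannian 1 - A. \<forall>y\<in>V.
          (real (covering_number r (orth_proj V ` X \<inter> cball y (2 / real (4 * m)))))\<^sup>2
            \<le> real (covering_number r X) * n * real (4 * m) powr (2 * \<epsilon>))"
    using exceptional_directions[OF \<gamma> X] by blast
  \<comment> \<open>The ratio of the two radii is \<open>R powr (- q)\<close>, so a loss
    \<open>\<epsilon>\<close> in the final exponent permits a loss \<open>\<epsilon> * q\<close> in
    powers of \<open>1 / R\<close>.\<close>
  define q where "q = 1 / \<theta> - 1"
  have q: "0 < q" "q * d / (1 - \<theta>) = d / \<theta>"
    using \<theta> by (auto simp: q_def field_simps)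
  define \<beta> where "\<beta> = (d / (1 - \<theta>) + \<alpha>) / 2 + \<epsilon>"
  have \<beta>: "0 < \<beta>" using d(1) \<theta> \<alpha>(1) \<epsilon> by (simp add: \<beta>_def add_nonneg_pos)
  have scale: "R / R powr (1 / \<theta>) = R powr (- q)" if "0 < R" for R
    using that by (simp add: q_def powr_diff)
  define J where "J i = (4::nat) * 2 ^ i" for i
  define r where "r i = (1 / real (J i)) powr (1 / \<theta>)" for i
  have J: "4 \<le> real (J i)" for i by (simp add: J_def)
  have r: "0 < r i" "r i \<le> 1 / real (J i)" for i
  proof -
    show "0 < r i" using J[of i] by (simp add: r_def)
    have "(1 / real (J i)) powr (1 / \<theta>) \<le> (1 / real (J i)) powr 1"
      using J[of i] \<theta> by (intro powr_mono') auto
    then show "r i \<le> 1 / real (J i)" using J[of i] by (simp add: r_def)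
  qed
  have n: "0 < C * real (J i) powr (q * \<alpha>)" for i
    using \<alpha>(2) J[of i] by simp
  have loc: "real (covering_number (r i) (X \<inter> cball x (1 / real (J i)))) \<le> C * real (J i) powr (q * \<alpha>)"
    if "x \<in> X" for x i
  proof -
    have "(1 / real (J i)) / (1 / real (J i)) powr (1 / \<theta>) = real (J i) powr q"
      using J[of i] by (subst scale) (auto simp: powr_divide powr_minus field_simps)
    then show ?thesis
      using \<alpha>(3)[of "1 / real (J i)" x] that J[of i] by (simp add: r_def powr_powr)
  qed
  have "\<exists>A. A \<in> sets \<gamma> \<and> measure \<gamma> A \<le> K * sqrt (1 + ln (real (J i))) * real (J i) powr (- (\<epsilon> * q)) \<and>
        (\<forall>V\<in>grassmannian 1 - A. \<forall>y\<in>V.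
          (real (covering_number (r i) (orth_proj V ` X \<inter> cball y (2 / real (J i)))))\<^sup>2
            \<le> real (covering_number (r i) X) * (C * real (J i) powr (q * \<alpha>)) * real (J i) powr (2 * (\<epsilon> * q)))" for i
    using K[of "2 ^ i" "r i" "\<epsilon> * q" "C * real (J i) powr (q * \<alpha>)"] r[of i] n[of i] loc[of _ i] \<epsilon> q(1)
    unfolding J_def[symmetric] by force
  then obtain A where A: "\<And>i. A i \<in> sets \<gamma>"
      "\<And>i. measure \<gamma> (A i) \<le> K * sqrt (1 + ln (real (J i))) * real (J i) powr (- (\<epsilon> * q))"
      "\<And>i V y. V \<in> grassmannian 1 - A i \<Longrightarrow> y \<in> V \<Longrightarrow>
          (real (covering_number (r i) (orth_proj V ` X \<inter> cball y (2 / real (J i)))))\<^sup>2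
            \<le> real (covering_number (r i) X) * (C * real (J i) powr (q * \<alpha>)) * real (J i) powr (2 * (\<epsilon> * q))"
    by metis
  have "summable (\<lambda>i. measure \<gamma> (A i))"
  proof (rule summable_comparison_test')
    \<comment> \<open>Half of the decay \<open>J powr (- p)\<close> pays for the root of the
      logarithm; the other half leaves a geometric series of ratio
      \<open>2 powr (- p / 2)\<close>.\<close>
    define p where "p = \<epsilon> * q"
    have p: "0 < p" using \<epsilon> q by (simp add: p_def)
    let ?c = "\<bar>K\<bar> * sqrt (1 + 1 / p) * 4 powr (- p / 2)"
    show "summable (\<lambda>i. ?c * (2 powr (- p / 2)) ^ i)"
    proof (intro summable_mult summable_geometric)
      have "2 powr (- p / 2) < 2 powr (0::real)" using p by (intro powr_less_mono) auto
      then show "norm (2 powr (- p / 2) :: real) < 1" by simp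
    qed
    fix i :: nat
    assume "0 \<le> i"
    let ?J = "real (J i)"
    have "1 \<le> ?J powr p" using J[of i] p by (intro ge_one_powr_ge_zero) auto
    moreover have "ln ?J \<le> ?J powr p / p" using J[of i] p by (intro ln_powr_bound) auto
    ultimately have "1 + ln ?J \<le> (1 + 1 / p) * ?J powr p" by (simp add: algebra_simps)
    then have "sqrt (1 + ln ?J) \<le> sqrt (1 + 1 / p) * ?J powr (p / 2)"
      using J[of i] by (simp add: powr_half_sqrt_powr flip: real_sqrt_mult)
    then have "\<bar>K\<bar> * sqrt (1 + ln ?J) * ?J powr (- p) \<le> \<bar>K\<bar> * (sqrt (1 + 1 / p) * ?J powr (p / 2)) * ?J powr (- p)"
      by (intro mult_right_mono mult_left_mono) auto
    also have "\<dots> = \<bar>K\<bar> * sqrt (1 + 1 / p) * ?J powr (- p / 2)"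
      by (simp add: mult.assoc flip: powr_add)
    also have "?J powr (- p / 2) = 4 powr (- p / 2) * (2 powr (- p / 2)) ^ i"
    proof -
      have "(2 ^ i) powr (- p / 2) = (2 powr (- p / 2)) ^ i"
        by (simp add: powr_powr mult.commute flip: powr_realpow)
      then show ?thesis by (simp add: J_def powr_mult)
    qed
    finally have "\<bar>K\<bar> * sqrt (1 + ln ?J) * ?J powr (- p) \<le> ?c * (2 powr (- p / 2)) ^ i"
      by (simp only: mult.assoc)
    \<comment> \<open>The sign of \<open>K\<close> is not given, hence the passage to its absolute
      value.\<close>
    moreover have "K * (sqrt (1 + ln ?J) * ?J powr (- p)) \<le> \<bar>K\<bar> * (sqrt (1 + ln ?J) * ?J powr (- p))"
      using J[of i] by (intro mult_right_mono) auto
    ultimately show "norm (measure \<gamma> (A i)) \<le> ?c * (2 powr (- p / 2)) ^ i"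
      using A(2)[of i] by (simp add: p_def mult.assoc)
  qed
  then have "AE V in \<gamma>. eventually (\<lambda>i. V \<in> space \<gamma> - A i) sequentially"
    using A(1) by (intro borel_cantelli_AE1) (auto simp: emeasure_eq_measure)
  then show ?thesis
  proof (rule AE_mp, intro AE_I2 impI)
    fix V assume "V \<in> space \<gamma>" and "eventually (\<lambda>i. V \<in> space \<gamma> - A i) sequentially"
    moreover have sp: "space \<gamma> = grassmannian 1"
      using \<gamma> space_grassmannian_borel sets_eq_imp_space_eq unfolding rotation_invariant_prob_def by metis
    ultimately have V: "V \<in> grassmannian 1"
      and "eventually (\<lambda>i. V \<in> grassmannian 1 - A i) sequentially" by auto
    moreover have "eventually (\<lambda>i. r i < r0) sequentially"
    proof -
      have "(\<lambda>i. (1 / 2) ^ i :: real) \<longlonglongrightarrow> 0" by (rule LIMSEQ_power_zero) simp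
      then have "eventually (\<lambda>i. (1 / 2) ^ i < r0) sequentially"
        using d(2) by (rule order_tendstoD)
      then show ?thesis
      proof eventually_elim
        case (elim i)
        have "1 / real (J i) \<le> (1 / 2) ^ i" by (simp add: J_def power_divide field_simps)
        then show ?case using r(2)[of i] elim by linarith
      qed
    qed
    ultimately have "eventually (\<lambda>i. V \<in> grassmannian 1 - A i \<and> r i < r0) sequentially"
      by (intro eventually_conj)
    then obtain N where N: "\<And>i. N \<le> i \<Longrightarrow> V \<in> grassmannian 1 - A i" "\<And>i. N \<le> i \<Longrightarrow> r i < r0"
      unfolding eventually_sequentially by blast
    let ?P = "orth_proj V ` X"
    have bP: "bounded ?P" by (rule bounded_orth_proj_image[OF V X])
    have PV: "y \<in> V" if "y \<in> ?P" for y
      using that V orth_proj_props(1) by (auto simp: grassmannian_def)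
    have dyadic: "real (covering_number (r i) (?P \<inter> cball y (2 / real (J i)))) \<le> sqrt C * real (J i) powr (q * \<beta>)"
      if i: "N \<le> i" and y: "y \<in> ?P" for i y
    proof -
      let ?J = "real (J i)"
      have "real (covering_number (r i) X) \<le> r i powr (- d)"
        using d(3) r(1) N(2)[OF i] by blast
      also have "r i powr (- d) = ?J powr (q * d / (1 - \<theta>))"
        unfolding q(2) r_def using J[of i] by (simp add: powr_powr powr_divide powr_minus field_simps)
      finally have 1: "real (covering_number (r i) X) \<le> ?J powr (q * d / (1 - \<theta>))" .
      have "(real (covering_number (r i) (?P \<inter> cball y (2 / ?J))))\<^sup>2
          \<le> real (covering_number (r i) X) * (C * ?J powr (q * \<alpha>)) * ?J powr (2 * (\<epsilon> * q))"
        using A(3) N(1)[OF i] PV[OF y] by blast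
      also have "\<dots> \<le> ?J powr (q * d / (1 - \<theta>)) * (C * ?J powr (q * \<alpha>)) * ?J powr (2 * (\<epsilon> * q))"
        using 1 n[of i] by (intro mult_right_mono) auto
      also have "\<dots> = C * (?J powr (q * d / (1 - \<theta>)) * ?J powr (q * \<alpha>) * ?J powr (2 * (\<epsilon> * q)))"
        by simp
      \<comment> \<open>The three exponents add up to \<open>2 * q * \<beta>\<close>; taking the
        root is the source of the factor 1/2 in \<open>\<beta>\<close>.\<close>
      also have "\<dots> = C * ?J powr (q * \<beta> + q * \<beta>)"
        unfolding powr_add[symmetric] \<beta>_def by (simp add: algebra_simps)
      also have "\<dots> = (sqrt C * ?J powr (q * \<beta>))\<^sup>2"
        using \<alpha>(2) unfolding powr_add by (simp add: power_mult_distrib) (simp add: power2_eq_square)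
      finally show ?thesis
        by (rule power2_le_imp_le) (use \<alpha>(2) in simp)
    qed
    \<comment> \<open>\<open>D\<close> bounds the covering numbers for all
      \<open>R \<ge> 1 / J N\<close> at once.\<close>
    define D where "D = real (covering_number ((1 / real (J N)) powr (1 / \<theta>)) ?P)"
    define C' where "C' = sqrt C * 2 powr (q * \<beta>) + D"
    have C': "0 < C'" "sqrt C * 2 powr (q * \<beta>) \<le> C'" "D \<le> C'"
      using \<alpha>(2) by (auto simp: C'_def D_def add_pos_nonneg)
    have "real (covering_number (R powr (1 / \<theta>)) (?P \<inter> cball y R)) \<le> C' * (R / R powr (1 / \<theta>)) powr \<beta>"
      if R: "0 < R" "R < 1" and y: "y \<in> ?P" for R y
    proof (cases "R < 1 / real (J N)")
      case True
      obtain k where k: "1 / R < 2 ^ k" using real_arch_pow[of 2 "1 / R"] by auto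
      have "1 / real (J k) \<le> 1 / 2 ^ k" by (simp add: J_def field_simps)
      also have "\<dots> \<le> R" using k R(1) by (simp add: field_simps)
      finally have ex: "\<exists>i. 1 / real (J i) \<le> R" by blast
      define i where "i = (LEAST i. 1 / real (J i) \<le> R)"
      have i: "1 / real (J i) \<le> R" unfolding i_def by (rule LeastI_ex[OF ex])
      have "\<not> i \<le> N"
      proof
        assume "i \<le> N"
        then have "1 / real (J N) \<le> 1 / real (J i)"
          by (simp add: J_def divide_left_mono power_increasing)
        then show False using i True by linarith
      qed
      then obtain j where j: "i = Suc j" "N \<le> j" by (cases i) auto
      \<comment> \<open>By minimality of \<open>i\<close>, the radius \<open>R\<close> lies below
        \<open>1 / J j = 2 / J i\<close>; this is where the doubled balls are used.\<close>
      have "\<not> 1 / real (J j) \<le> R" using j(1) not_less_Least[of j "\<lambda>i. 1 / real (J i) \<le> R"] unfolding i_def by simp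
      then have R2: "R \<le> 2 / real (J i)" by (simp add: j(1) J_def)
      have "covering_number (R powr (1 / \<theta>)) (?P \<inter> cball y R) \<le> covering_number (r i) (?P \<inter> cball y (2 / real (J i)))"
      proof (rule covering_number_mono)
        show "r i \<le> R powr (1 / \<theta>)"
          unfolding r_def using i \<theta> by (intro powr_mono2) auto
      qed (use R2 r bP in auto)
      then have "real (covering_number (R powr (1 / \<theta>)) (?P \<inter> cball y R))
          \<le> real (covering_number (r i) (?P \<inter> cball y (2 / real (J i))))" by simp
      also have "\<dots> \<le> sqrt C * real (J i) powr (q * \<beta>)"
        using dyadic[OF _ y, of i] j by simp
      \<comment> \<open>Passing from the dyadic scale back to \<open>R\<close> costs the factor
        \<open>2 powr (q * \<beta>)\<close> built into \<open>C'\<close>.\<close>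
      also have "\<dots> \<le> sqrt C * (2 / R) powr (q * \<beta>)"
        using R2 R(1) J[of i] q \<beta> \<alpha>(2) by (intro mult_left_mono powr_mono2) (auto simp: field_simps)
      also have "\<dots> = sqrt C * 2 powr (q * \<beta>) * (R powr (- q)) powr \<beta>"
        using R(1) by (simp add: powr_divide powr_powr powr_minus field_simps)
      also have "\<dots> \<le> C' * (R powr (- q)) powr \<beta>"
        using C'(2) by (intro mult_right_mono) auto
      finally show ?thesis using scale[OF R(1)] by simp
    next
      case False
      have "covering_number (R powr (1 / \<theta>)) (?P \<inter> cball y R) \<le> covering_number ((1 / real (J N)) powr (1 / \<theta>)) ?P"
      proof (rule covering_number_mono)
        show "(1 / real (J N)) powr (1 / \<theta>) \<le> R powr (1 / \<theta>)"
          using False \<theta> by (intro powr_mono2) auto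
      qed (use J[of N] bP in auto)
      then have "real (covering_number (R powr (1 / \<theta>)) (?P \<inter> cball y R)) \<le> C' * 1"
        using C'(3) by (simp add: D_def)
      also have "\<dots> \<le> C' * (R powr (- q * \<beta>))"
      proof (intro mult_left_mono)
        have "R powr 0 \<le> R powr (- q * \<beta>)"
          using R q \<beta> by (intro powr_mono') auto
        then show "1 \<le> R powr (- q * \<beta>)" using R(1) by simp
      qed (use C' in auto)
      finally show ?thesis using scale[OF R(1)] by (simp add: powr_powr)
    qed
    then have "ereal \<beta> \<in> {ereal \<alpha> | \<alpha>. 0 \<le> \<alpha> \<and> (\<exists>C>0. \<forall>R. 0 < R \<and> R < 1 \<longrightarrow> (\<forall>x\<in>?P.
          real (covering_number (R powr (1/\<theta>)) (?P \<inter> cball x R)) \<le> C * (R / R powr (1/\<theta>)) powr \<alpha>))}"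
      using \<beta> C'(1) by (intro CollectI exI[of _ \<beta>] conjI refl exI[of _ C']) auto
    then have "assouad_spectrum \<theta> ?P \<le> ereal \<beta>"
      unfolding assouad_spectrum_def by (rule Inf_lower)
    then show "assouad_spectrum \<theta> ?P \<le> ereal ((d / (1 - \<theta>) + \<alpha>) / 2 + \<epsilon>)"
      by (simp add: \<beta>_def)
  qed
qed

section \<open>From exponents to dimensions\<close>

lemma assouad_spectrum_nonneg: "0 \<le> assouad_spectrum \<theta> X"
  unfolding assouad_spectrum_def by (rule Inf_greatest) auto

lemma assouad_spectrum_empty: "assouad_spectrum \<theta> {} = 0"
proof (rule antisym[OF _ assouad_spectrum_nonneg])
  have "ereal 0 \<in> {ereal \<alpha> | \<alpha>. 0 \<le> \<alpha> \<and> (\<exists>C>0. \<forall>R. 0 < R \<and> R < 1 \<longrightarrow> (\<forall>x\<in>{}.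
      real (covering_number (R powr (1/\<theta>)) ({} \<inter> cball x R)) \<le> C * (R / R powr (1/\<theta>)) powr \<alpha>))}"
    by (intro CollectI exI[of _ 0] exI[of _ "1::real"] conjI refl) auto
  then show "assouad_spectrum \<theta> {} \<le> 0"
    unfolding assouad_spectrum_def zero_ereal_def by (rule Inf_lower)
qed

lemma upper_box_dim_nonneg:
  assumes "bounded X"
  shows "0 \<le> upper_box_dim X"
proof (cases "X = {}")
  case False
  have "eventually (\<lambda>r. r \<in> {0<..<1::real}) (at_right 0)"
    by (rule eventually_at_right_real) simp
  then have "eventually (\<lambda>r. 0 \<le> ereal (ln (real (covering_number r X)) / (- ln r))) (at_right (0::real))"
  proof eventually_elim
    case (elim r)
    then have "1 \<le> covering_number r X" using covering_number_pos[OF assms, of r] False by auto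
    then show ?case using elim by (auto intro!: divide_nonneg_neg simp: ln_less_zero)
  qed
  then show ?thesis
    unfolding upper_box_dim_def using False by (auto intro: le_Limsup)
qed (simp add: upper_box_dim_def)

lemma covering_number_le_powr:
  assumes "bounded X" "X \<noteq> {}" "upper_box_dim X < ereal d"
  obtains r0 where "0 < r0" "\<And>r. 0 < r \<Longrightarrow> r < r0 \<Longrightarrow> real (covering_number r X) \<le> r powr (- d)"
proof -
  have "Limsup (at_right 0) (\<lambda>r. ereal (ln (real (covering_number r X)) / (- ln r))) < ereal d"
    using assms by (simp add: upper_box_dim_def)
  then have "eventually (\<lambda>r. ereal (ln (real (covering_number r X)) / (- ln r)) < ereal d) (at_right 0)"
    by (rule Limsup_lessD)
  then obtain b where b: "0 < b"
    "\<And>r. 0 < r \<Longrightarrow> r < b \<Longrightarrow> ln (real (covering_number r X)) / (- ln r) < d"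
    unfolding eventually_at_right_field by auto
  show thesis
  \<comment> \<open>The cap at 1 makes \<open>- ln r\<close> positive, so the quotient can be
    cleared.\<close>
  proof (rule that[of "min b 1"])
    show "0 < min b 1" using b(1) by simp
    fix r assume r: "0 < r" "r < min b 1"
    have N: "0 < real (covering_number r X)" using covering_number_pos assms r by simp
    have "ln (real (covering_number r X)) / (- ln r) < d" using b(2) r by simp
    moreover have "0 < - ln r" using r by simp
    ultimately have "ln (real (covering_number r X)) < d * (- ln r)"
      by (simp only: pos_divide_less_eq)
    then have "exp (ln (real (covering_number r X))) \<le> exp (- d * ln r)"
      by simp
    then show "real (covering_number r X) \<le> r powr (- d)"
      using N r by (simp add: powr_def)
  qed
qed

theorem theorem2p4:
  fixes X :: "(real ^ 2) set" and \<theta> :: real and \<gamma> :: "(real ^ 2) set measure"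
  assumes "rotation_invariant_prob 1 \<gamma>"
    and "bounded X"
    and "0 < \<theta>" and "\<theta> < 1"
  shows "AE V in \<gamma>. assouad_spectrum \<theta> (orth_proj V ` X)
           \<le> ereal (1/2) * (upper_box_dim X / ereal (1 - \<theta>) + assouad_spectrum \<theta> X)"
proof (cases "X = {}")
  case True
  then show ?thesis
    by (simp add: assouad_spectrum_empty upper_box_dim_def)
next
  case False
  have nn: "0 \<le> upper_box_dim X" "0 \<le> assouad_spectrum \<theta> X"
    using upper_box_dim_nonneg[OF assms(2)] assouad_spectrum_nonneg by auto
  \<comment> \<open>An infinite dimension makes the right-hand side infinite, as both summands are
    nonnegative; otherwise both dimensions are real numbers.\<close>
  show ?thesis
  proof (cases "upper_box_dim X = \<infinity> \<or> assouad_spectrum \<theta> X = \<infinity>")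
    case True
    then have "ereal (1/2) * (upper_box_dim X / ereal (1 - \<theta>) + assouad_spectrum \<theta> X) = \<infinity>"
      using assms(4) nn by (auto simp: divide_ereal_def)
    then show ?thesis by (simp only: ereal_less_eq(1) eventually_True)
  next
    case fin: False
    then obtain d a where da: "upper_box_dim X = ereal d" "assouad_spectrum \<theta> X = ereal a"
      using nn by (cases "upper_box_dim X"; cases "assouad_spectrum \<theta> X") auto
    have d: "0 \<le> d" and a: "0 \<le> a" using nn da by auto
    define s where "s = (d / (1 - \<theta>) + a) / 2"
    have rhs: "ereal (1/2) * (upper_box_dim X / ereal (1 - \<theta>) + assouad_spectrum \<theta> X) = ereal s"
      using assms(4) by (simp add: da s_def)
    \<comment> \<open>The null set depends on the slack, so the slack runs through a sequence and
      countably many null sets are united.\<close>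
    have "AE V in \<gamma>. assouad_spectrum \<theta> (orth_proj V ` X) \<le> ereal (s + inverse (real (Suc k)))" for k
    proof -
      define e where "e = inverse (real (Suc k))"
      have e: "0 < e" by (simp add: e_def)
      \<comment> \<open>The slack \<open>(1 - \<theta>) * e / 2\<close> becomes \<open>e / 2\<close>
        after division by \<open>1 - \<theta>\<close>. With \<open>e / 2\<close> for
        \<open>\<alpha>\<close>, the halved total is \<open>e / 2\<close>, and the remaining
        \<open>e / 2\<close> is the loss allowed in the previous lemma.\<close>
      obtain r0 where r0: "0 < r0"
          "\<And>r. 0 < r \<Longrightarrow> r < r0 \<Longrightarrow> real (covering_number r X) \<le> r powr (- (d + (1 - \<theta>) * e / 2))"
        using covering_number_le_powr[OF assms(2) False, of "d + (1 - \<theta>) * e / 2"] e assms(4) da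
        by auto
      have "assouad_spectrum \<theta> X < ereal (a + e / 2)" using da e by simp
      then obtain \<alpha> C where \<alpha>: "0 \<le> \<alpha>" "\<alpha> < a + e / 2" "0 < C"
        "\<And>R x. 0 < R \<Longrightarrow> R < 1 \<Longrightarrow> x \<in> X \<Longrightarrow>
          real (covering_number (R powr (1 / \<theta>)) (X \<inter> cball x R)) \<le> C * (R / R powr (1 / \<theta>)) powr \<alpha>"
        unfolding assouad_spectrum_def Inf_less_iff by auto
      have "AE V in \<gamma>. assouad_spectrum \<theta> (orth_proj V ` X)
          \<le> ereal (((d + (1 - \<theta>) * e / 2) / (1 - \<theta>) + \<alpha>) / 2 + e / 2)"
        by (rule AE_assouad_spectrum_orth_proj_le[OF assms \<alpha>(1,3,4) _ r0])
          (use d e assms(4) in auto)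
      moreover have "((d + (1 - \<theta>) * e / 2) / (1 - \<theta>) + \<alpha>) / 2 + e / 2 \<le> s + e"
      proof -
        have eq: "(d + (1 - \<theta>) * e / 2) / (1 - \<theta>) = d / (1 - \<theta>) + e / 2"
          using assms(4) by (simp add: field_simps)
        show ?thesis using \<alpha>(2) unfolding s_def eq by (simp add: add_divide_distrib)
      qed
      ultimately show ?thesis
        unfolding e_def[symmetric] by (elim AE_mp, intro AE_I2 impI) (metis ereal_less_eq(3) order_trans)
    qed
    then have "AE V in \<gamma>. \<forall>k. assouad_spectrum \<theta> (orth_proj V ` X) \<le> ereal (s + inverse (real (Suc k)))"
      by (simp add: AE_all_countable)
    then show ?thesis
      unfolding rhs
    proof (rule AE_mp, intro AE_I2 impI)
      fix V assume *: "\<forall>k. assouad_spectrum \<theta> (orth_proj V ` X) \<le> ereal (s + inverse (real (Suc k)))"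
      have "(\<lambda>k. ereal (s + inverse (real (Suc k)))) \<longlonglongrightarrow> ereal s"
        by (intro tendsto_ereal LIMSEQ_inverse_real_of_nat_add)
      then show "assouad_spectrum \<theta> (orth_proj V ` X) \<le> ereal s"
        by (rule LIMSEQ_le_const) (use * in blast)
    qed
  qed
qed

end
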